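(* Let $E$ and $F$ be Banach lattices such that $E$ has the subsequence splitting property, and $F$ has order continuous norm and the DP$^{\star}$ property. Then every disjoint weak$^{\star}$ Dunford-Pettis operator $T:E\to F$ is L-weakly compact.
   Context: "Operator" means bounded linear map; $B_E$ is the closed unit ball of $E$. A norm bounded subset $A$ of a Banach lattice is L-weakly compact if every disjoint sequence in the solid hull of $A$ converges to $0$ in norm; a sequence is L-weakly compact if its set of terms is. An operator $T:E\to F$ is L-weakly compact if $T(B_E)$ is an L-weakly compact subset of $F$. An order continuous Banach lattice $E$ has the subsequence splitting property if for every norm bounded sequence $(x_n)$ in $E$ there exist a subsequence $(x_{n_k})$ and two sequences $(y_k)$, $(z_k)$ in $E$ such that $x_{n_k}=y_k+z_k$, $(y_k)$ is L-weakly compact, $(z_k)$ is pairwise disjoint, and $y_k\perp z_k$ for all $k$. A Banach space $X$ has the Dunford-Pettis$^{\star}$ (DP$^{\star}$) property if $f_n(x_n)\to0$ for every weakly null sequence $(x_n)$ in $X$ and every weak$^{\star}$ null sequence $(f_n)$ in $X'$. An operator $T:E\to F$ is disjoint weak$^{\star}$ Dunford-Pettis if $\lim_{n\to\infty} f_n(Tx_n)=0$ for every norm bounded disjoint sequence $(x_n)$ in $E$ and every weak$^{\star}$ null sequence $(f_n)$ in $F'$. *)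

theory Defs
  imports "HOL-Analysis.Analysis" "HOL-Library.Lattice_Algebras"
begin

text \<open>Real Banach lattices. The class \<^class>\<open>lattice_ab_group_add_abs\<close> fixes
  \<open>\<bar>x\<bar> = sup x (- x)\<close>, and \<^class>\<open>ordered_real_vector\<close> makes the
  lattice order compatible with the vector space structure.\<close>

class banach_lattice = banach + ordered_real_vector + lattice_ab_group_add_abs +
  assumes norm_le_of_abs_le: "\<bar>x\<bar> \<le> \<bar>y\<bar> \<Longrightarrow> norm x \<le> norm y"

definition lat_disjoint :: "'a::banach_lattice \<Rightarrow> 'a \<Rightarrow> bool"
  where "lat_disjoint x y \<longleftrightarrow> inf \<bar>x\<bar> \<bar>y\<bar> = 0"

definition disjoint_seq :: "(nat \<Rightarrow> 'a::banach_lattice) \<Rightarrow> bool"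
  where "disjoint_seq x \<longleftrightarrow> (\<forall>i j. i \<noteq> j \<longrightarrow> lat_disjoint (x i) (x j))"

definition solid_hull :: "'a::banach_lattice set \<Rightarrow> 'a set"
  where "solid_hull A = {x. \<exists>a\<in>A. \<bar>x\<bar> \<le> \<bar>a\<bar>}"

definition L_weakly_compact :: "'a::banach_lattice set \<Rightarrow> bool"
  where "L_weakly_compact A \<longleftrightarrow> bounded A \<and>
    (\<forall>x. (\<forall>n. x n \<in> solid_hull A) \<and> disjoint_seq x \<longrightarrow> x \<longlonglongrightarrow> 0)"

definition L_weakly_compact_op :: "('a::banach_lattice \<Rightarrow>\<^sub>L 'b::banach_lattice) \<Rightarrow> bool"
  where "L_weakly_compact_op T \<longleftrightarrow> L_weakly_compact (blinfun_apply T ` cball 0 1)"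

text \<open>Order continuity of the norm: every net decreasing to \<open>0\<close> in order converges to
  \<open>0\<close> in norm. A decreasing net is represented by its range, a downward directed set,
  which indexes itself by the reverse order. The second and third premises say that the greatest
  lower bound of \<open>D\<close> is \<open>0\<close>; \<^const>\<open>Inf\<close> is not available
  because the lattice is not assumed to be complete.\<close>

definition order_continuous_norm :: "'a::banach_lattice itself \<Rightarrow> bool"
  where "order_continuous_norm _ \<longleftrightarrow> (\<forall>D::'a set.
    D \<noteq> {} \<and> (\<forall>x\<in>D. \<forall>y\<in>D. \<exists>z\<in>D. z \<le> x \<and> z \<le> y) \<and>
    (\<forall>x\<in>D. 0 \<le> x) \<and> (\<forall>l. (\<forall>x\<in>D. l \<le> x) \<longrightarrow> l \<le> 0) \<longrightarrow>
    (\<forall>e>0. \<exists>d\<in>D. \<forall>x\<in>D. x \<le> d \<longrightarrow> norm x < e))"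

text \<open>The subsequence splitting property is a notion for order continuous Banach lattices, so
  order continuity of the norm is part of it.\<close>

definition subsequence_splitting_property :: "'a::banach_lattice itself \<Rightarrow> bool"
  where "subsequence_splitting_property _ \<longleftrightarrow> order_continuous_norm TYPE('a) \<and>
    (\<forall>x::nat \<Rightarrow> 'a. bounded (range x) \<longrightarrow>
      (\<exists>r y z. strict_mono r \<and> (\<forall>k. x (r k) = y k + z k) \<and>
        L_weakly_compact (range y) \<and> disjoint_seq z \<and> (\<forall>k. lat_disjoint (y k) (z k))))"

definition weakly_null :: "(nat \<Rightarrow> 'a::real_normed_vector) \<Rightarrow> bool"
  where "weakly_null x \<longleftrightarrow> (\<forall>f::'a \<Rightarrow>\<^sub>L real. (\<lambda>n. blinfun_apply f (x n)) \<longlonglongrightarrow> 0)"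

definition weak_star_null :: "(nat \<Rightarrow> 'a::real_normed_vector \<Rightarrow>\<^sub>L real) \<Rightarrow> bool"
  where "weak_star_null f \<longleftrightarrow> (\<forall>x. (\<lambda>n. blinfun_apply (f n) x) \<longlonglongrightarrow> 0)"

definition DP_star_property :: "'a::banach itself \<Rightarrow> bool"
  where "DP_star_property _ \<longleftrightarrow> (\<forall>(x::nat \<Rightarrow> 'a) f.
    weakly_null x \<and> weak_star_null f \<longrightarrow> (\<lambda>n. blinfun_apply (f n) (x n)) \<longlonglongrightarrow> 0)"

definition disjoint_weak_star_DP :: "('a::banach_lattice \<Rightarrow>\<^sub>L 'b::banach_lattice) \<Rightarrow> bool"
  where "disjoint_weak_star_DP T \<longleftrightarrow> (\<forall>x f.
    bounded (range x) \<and> disjoint_seq x \<and> weak_star_null f \<longrightarrow>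
      (\<lambda>n. blinfun_apply (f n) (blinfun_apply T (x n))) \<longlonglongrightarrow> 0)"

end

theory Submission
  imports Defs
begin

text \<open>If \<open>T\<close> is not L-weakly compact, there are \<open>x n\<close> in the unit ball and disjoint \<open>w n\<close> with
  \<open>\<bar>w n\<bar> \<le> \<bar>T (x n)\<bar>\<close> and norms bounded away from \<open>0\<close>. Hahn--Banach functionals \<open>h n\<close> carried by the bands
  generated by the \<open>w n\<close> are weak* null, because \<open>F\<close> has order continuous norm, but \<open>h n (T (x n))\<close> stays
  away from \<open>0\<close>. Split a subsequence of \<open>x\<close> into \<open>y + z\<close>. The disjoint part \<open>z\<close> contributes nothing in the
  limit by the assumption on \<open>T\<close>. The L-weakly compact part \<open>y\<close> is order bounded up to a small error in
  norm, and order intervals of \<open>E\<close> are weakly sequentially compact, so that the DP* property of \<open>F\<close> makes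
  its contribution small as well.

  Weak sequential compactness of order intervals is obtained without representing \<open>E\<close> as a function space:
  there is a functional on the interval which is uniformly convex along the countable set that matters,
  and almost minimisers over convex hulls of tails converge in norm.\<close>

section \<open>Banach lattices\<close>

lemma scaleR_sup:
  fixes x y :: "'a::banach_lattice"
  assumes "0 \<le> c"
  shows "c *\<^sub>R sup x y = sup (c *\<^sub>R x) (c *\<^sub>R y)"
proof (cases "c = 0")
  case False
  then have c: "0 < c" using assms by simp
  have "sup x y \<le> inverse c *\<^sub>R sup (c *\<^sub>R x) (c *\<^sub>R y)"
    using c by (simp add: pos_le_divideR_eq)
  then have "c *\<^sub>R sup x y \<le> sup (c *\<^sub>R x) (c *\<^sub>R y)"
    using c by (simp only: pos_le_divideR_eq)
  moreover have "sup (c *\<^sub>R x) (c *\<^sub>R y) \<le> c *\<^sub>R sup x y"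
    using assms by (intro le_supI scaleR_left_mono) simp_all
  ultimately show ?thesis by (rule antisym)
qed simp

lemma scaleR_inf:
  fixes x y :: "'a::banach_lattice"
  assumes "0 \<le> c"
  shows "c *\<^sub>R inf x y = inf (c *\<^sub>R x) (c *\<^sub>R y)"
  using scaleR_sup[OF assms, of "- x" "- y"] by (simp only: inf_eq_neg_sup scaleR_minus_right)

lemma scaleR_abs:
  fixes x :: "'a::banach_lattice"
  assumes "0 \<le> c"
  shows "\<bar>c *\<^sub>R x\<bar> = c *\<^sub>R \<bar>x\<bar>"
  using assms by (simp add: abs_lattice scaleR_sup)

lemma scaleR_pprt:
  fixes x :: "'a::banach_lattice"
  assumes "0 \<le> c"
  shows "pprt (c *\<^sub>R x) = c *\<^sub>R pprt x"
  using assms by (simp add: pprt_def scaleR_sup)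

lemma norm_abs_lattice: "norm \<bar>x\<bar> = norm (x::'a::banach_lattice)"
  by (rule antisym; rule norm_le_of_abs_le) simp_all

lemma norm_mono_lattice:
  fixes x y :: "'a::banach_lattice"
  assumes "0 \<le> x" "x \<le> y"
  shows "norm x \<le> norm y"
proof (rule norm_le_of_abs_le)
  show "\<bar>x\<bar> \<le> \<bar>y\<bar>"
    using assms by (metis abs_of_nonneg order_trans)
qed

lemma norm_le_of_abs_le_pos:
  fixes x y :: "'a::banach_lattice"
  assumes "\<bar>x\<bar> \<le> y"
  shows "norm x \<le> norm y"
  using norm_mono_lattice[OF abs_ge_zero assms] by (simp add: norm_abs_lattice)

lemma pprt_le_abs: "pprt x \<le> \<bar>x::'a::banach_lattice\<bar>"
  by (simp add: pprt_def abs_ge_self)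

lemma norm_pprt_le: "norm (pprt x) \<le> norm (x::'a::banach_lattice)"
  using norm_mono_lattice[OF zero_le_pprt pprt_le_abs, of x] by (simp add: norm_abs_lattice)

lemma pprt_add_le: "pprt (x + y) \<le> pprt x + pprt (y::'a::banach_lattice)"
  by (simp add: pprt_def add_mono le_supI)

lemma pprt_subadd: "x \<le> y + z \<Longrightarrow> 0 \<le> z \<Longrightarrow> pprt x \<le> pprt y + (z::'a::banach_lattice)"
  by (metis order_trans pprt_add_le pprt_eq_id pprt_mono)

lemma inf_pprt_uminus: "inf (pprt x) (pprt (- x)) = (0::'a::banach_lattice)"
proof -
  have "pprt x = x + pprt (- x)"
    using prts[of x] by (metis pprt_neg diff_conv_add_uminus eq_diff_eq minus_minus)
  then have "inf (pprt x) (pprt (- x)) = inf x 0 + pprt (- x)"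
    by (simp add: add_inf_distrib_right)
  then show ?thesis by (simp only: pprt_neg nprt_def right_minus)
qed

section \<open>Closedness of the positive cone\<close>

text \<open>Since \<open>x n\<close> is positive, \<open>- l\<close> lies below
  \<open>x n - l\<close>. Hence the norm of the positive part of \<open>- l\<close> is at most the
  distance from \<open>x n\<close> to \<open>l\<close>.\<close>

lemma lim_nonneg_lattice:
  fixes x :: "nat \<Rightarrow> 'a::banach_lattice"
  assumes "x \<longlonglongrightarrow> l" "\<And>n. 0 \<le> x n"
  shows "0 \<le> l"
proof -
  have "pprt (- l) \<le> \<bar>x n - l\<bar>" for n
  proof -
    have "- l \<le> x n - l" using assms(2)[of n] by simp
    then show ?thesis
      unfolding pprt_def by (intro le_supI) (auto intro: order_trans[OF _ abs_ge_self])
  qed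
  then have "norm (pprt (- l)) \<le> norm (x n - l)" for n
    using norm_mono_lattice[OF zero_le_pprt] norm_abs_lattice by metis
  moreover have "(\<lambda>n. norm (x n - l)) \<longlonglongrightarrow> 0"
    using assms(1) LIM_zero tendsto_norm_zero by blast
  ultimately have "norm (pprt (- l)) \<le> 0"
    using LIMSEQ_le_const by blast
  then have "- l \<le> 0" by (simp add: le_zero_iff_zero_pprt)
  then show ?thesis by simp
qed

lemma lim_mono_lattice:
  fixes x y :: "nat \<Rightarrow> 'a::banach_lattice"
  assumes "x \<longlonglongrightarrow> a" "y \<longlonglongrightarrow> b" "\<And>n. x n \<le> y n"
  shows "a \<le> b"
proof -
  have "0 \<le> y n - x n" for n using assms(3)[of n] by (metis diff_ge_0_iff_ge)
  then have "0 \<le> b - a" using lim_nonneg_lattice[OF tendsto_diff[OF assms(2,1)]] by metis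
  then show ?thesis by (metis diff_ge_0_iff_ge)
qed

text \<open>Dividing by \<open>k\<close> puts \<open>l\<close> below a sequence that tends to 0 in
  norm, and order is preserved under norm limits.\<close>

lemma archimedean_lattice:
  fixes l y :: "'a::banach_lattice"
  assumes "\<And>k::nat. of_nat k *\<^sub>R l \<le> y"
  shows "l \<le> 0"
proof -
  have "l \<le> inverse (real (Suc k)) *\<^sub>R y" for k
    using assms[of "Suc k"] by (subst pos_le_divideR_eq) (simp_all del: of_nat_Suc)
  moreover have "(\<lambda>k. inverse (real (Suc k)) *\<^sub>R y) \<longlonglongrightarrow> 0 *\<^sub>R y"
    by (intro tendsto_scaleR tendsto_const LIMSEQ_inverse_real_of_nat)
  ultimately show ?thesis
    using lim_mono_lattice[OF tendsto_const, of _ "0::'a" l] by simp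
qed

section \<open>Infima of sums and disjointness\<close>

text \<open>By distributivity the right side is the infimum of the four sums \<open>a + b\<close>,
  \<open>c + b\<close>, \<open>a + c\<close> and \<open>c + c\<close>. The first is
  \<open>a + b\<close> itself and the others lie above \<open>c\<close>.\<close>

lemma inf_add_le:
  fixes a b c :: "'a::banach_lattice"
  assumes "0 \<le> a" "0 \<le> b" "0 \<le> c"
  shows "inf (a + b) c \<le> inf a c + inf b c"
proof -
  have "inf a c + inf b c = inf (inf (a + b) (c + b)) (inf (a + c) (c + c))"
    by (simp add: add_inf_distrib_right add_inf_distrib_left inf_aci)
  moreover have "c \<le> c + b" "c \<le> a + c" "c \<le> c + c" using assms by simp_all
  ultimately show ?thesis
    by (metis inf.coboundedI2 inf.cobounded1 inf.boundedI)
qed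

lemma inf_zero_mono:
  fixes a b c d :: "'a::banach_lattice"
  assumes "inf c d = 0" "0 \<le> a" "a \<le> c" "0 \<le> b" "b \<le> d"
  shows "inf a b = 0"
  using assms by (metis antisym inf.boundedI inf_mono)

text \<open>Scaling both elements by the same \<open>m\<close> preserves disjointness; with
  \<open>m = max 1 c\<close> the scaled pair dominates \<open>a\<close> and \<open>c\<close> times
  \<open>b\<close>.\<close>

lemma inf_scaleR_zero:
  fixes a b :: "'a::banach_lattice"
  assumes "inf a b = 0" "0 \<le> a" "0 \<le> b" "0 \<le> c"
  shows "inf a (c *\<^sub>R b) = 0"
proof -
  define m where "m = max 1 c"
  have m: "1 \<le> m" "c \<le> m" "0 \<le> m" by (auto simp: m_def)
  have "inf (m *\<^sub>R a) (m *\<^sub>R b) = 0"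
    using assms m by (simp flip: scaleR_inf)
  moreover have "a \<le> m *\<^sub>R a" "c *\<^sub>R b \<le> m *\<^sub>R b"
    using m assms scaleR_right_mono[of 1 m a] by (simp_all add: scaleR_right_mono)
  ultimately show ?thesis
    using assms by - (rule inf_zero_mono[of "m *\<^sub>R a" "m *\<^sub>R b"], simp_all add: scaleR_nonneg_nonneg)
qed

section \<open>Triangle defects and layers\<close>

text \<open>The triangle inequality is strict where \<open>a\<close> and \<open>b\<close> have
  opposite signs. This quantifies the strict convexity of the absolute value and is the source of
  the uniform convexity used later.\<close>

lemma abs_add_defect:
  fixes a b :: "'a::banach_lattice"
  shows "2 *\<^sub>R inf (pprt a) (pprt (- b)) \<le> \<bar>a\<bar> + \<bar>b\<bar> - \<bar>a + b\<bar>"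
proof -
  let ?i = "inf (pprt a) (pprt (- b))"
  have a: "\<bar>a\<bar> = 2 *\<^sub>R pprt a - a" for a :: 'a
    using prts[of a] by (simp add: abs_prts scaleR_2 algebra_simps)
  have b: "\<bar>b\<bar> = 2 *\<^sub>R pprt (- b) + b"
    using a[of "- b"] by simp
  have "2 *\<^sub>R ?i \<le> 2 *\<^sub>R pprt a" "2 *\<^sub>R ?i \<le> 2 *\<^sub>R pprt (- b)"
    by (simp_all add: scaleR_left_mono)
  then have "2 *\<^sub>R ?i \<le> \<bar>a\<bar> + a" "2 *\<^sub>R ?i \<le> \<bar>b\<bar> - b"
    by (simp_all add: a[of a] b)
  then have "2 *\<^sub>R ?i + (a + b) \<le> \<bar>a\<bar> + \<bar>b\<bar>" "2 *\<^sub>R ?i - (a + b) \<le> \<bar>a\<bar> + \<bar>b\<bar>"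
    using add_mono[of a "\<bar>a\<bar>" "2 *\<^sub>R ?i" "\<bar>b\<bar> - b"] add_mono[of "- b" "\<bar>b\<bar>" "2 *\<^sub>R ?i" "\<bar>a\<bar> + a"]
    by (simp_all add: abs_ge_self abs_ge_minus_self algebra_simps)
  then have "a + b \<le> \<bar>a\<bar> + \<bar>b\<bar> - 2 *\<^sub>R ?i" "- (a + b) \<le> \<bar>a\<bar> + \<bar>b\<bar> - 2 *\<^sub>R ?i"
    by (simp_all add: algebra_simps)
  then have "\<bar>a + b\<bar> \<le> \<bar>a\<bar> + \<bar>b\<bar> - 2 *\<^sub>R ?i"
    by (rule abs_leI)
  then show ?thesis by (simp add: algebra_simps)
qed

text \<open>The left side is the layer of \<open>x\<close> between the levels \<open>a\<close> and
  \<open>a + e\<close>. It is at most the positive part of \<open>x - a\<close>, and at most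
  \<open>e\<close>, which in turn is covered by the positive part of \<open>a - y\<close> and the
  layer of \<open>y\<close> between \<open>a - e\<close> and \<open>a\<close>. Adding the layer of
  \<open>y\<close> to both bounds and taking the infimum gives the claim.\<close>

lemma slice_le:
  fixes x y a e :: "'a::banach_lattice"
  assumes "0 \<le> e"
  shows "inf x (a + e) - inf x a \<le> inf (pprt (x - a)) (pprt (a - y)) + (inf y a - inf y (a - e))"
proof -
  have "inf y (a - e) \<le> inf y a" using assms by (intro inf_mono) simp_all
  then have y: "0 \<le> inf y a - inf y (a - e)" by (metis diff_ge_0_iff_ge)
  have p: "pprt (z - w) = z - inf w z" for z w :: 'a
    by (simp add: pprt_def add_sup_distrib_left sup.commute)
  have "inf x (a + e) \<le> x" by simp
  then have "inf x (a + e) - inf x a \<le> x - inf x a" by (metis diff_right_mono)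
  then have 1: "inf x (a + e) - inf x a \<le> pprt (x - a)"
    unfolding p by (simp only: inf_commute)
  have "inf x (a + e) \<le> inf x a + e" using assms
    by (simp add: add_inf_distrib_right le_infI1)
  then have 2: "inf x (a + e) - inf x a \<le> e" by (metis diff_le_eq add.commute)
  have "e + inf y (a - e) = inf (y + e) a" by (simp add: add_inf_distrib_left add.commute)
  then have "e + inf y (a - e) \<le> a" by simp
  moreover have "e \<le> (a - i) + (i - k)" if "e + k \<le> a" for i k
    using that by (simp add: algebra_simps)
  ultimately have "e \<le> pprt (a - y) + (inf y a - inf y (a - e))"
    unfolding p by metis
  with 2 have "inf x (a + e) - inf x a \<le> pprt (a - y) + (inf y a - inf y (a - e))"
    by (rule order_trans)
  moreover have "inf x (a + e) - inf x a \<le> pprt (x - a) + (inf y a - inf y (a - e))"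
    using add_mono[OF 1 y] by simp
  ultimately show ?thesis
    unfolding add_inf_distrib_right by (metis le_infI)
qed

text \<open>Cut \<open>x\<close> into \<open>N\<close> layers of thickness \<open>e\<close>, apply
  \<open>slice_le\<close> to each and telescope the layers of both \<open>x\<close> and
  \<open>y\<close>.\<close>

lemma grid_le:
  fixes x y u :: "'a::banach_lattice"
  assumes "0 \<le> x" "x \<le> u" "0 \<le> y" "0 < N"
  shows "x - y \<le> (1 / real N) *\<^sub>R u
    + (\<Sum>j<N. inf (pprt (x - (real j / real N) *\<^sub>R u)) (pprt ((real j / real N) *\<^sub>R u - y)))"
proof -
  define e where "e = (1 / real N) *\<^sub>R u"
  define q where "q j = (real j / real N) *\<^sub>R u" for j
  have u: "0 \<le> u" using assms by (meson order_trans)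
  then have e: "0 \<le> e" by (simp add: e_def scaleR_nonneg_nonneg)
  have q: "q (Suc j) = q j + e" for j
    by (simp add: q_def e_def add_divide_distrib scaleR_add_left[symmetric])
  have q0: "q 0 = 0" and qN: "q N = u" using assms by (simp_all add: q_def)
  \<comment> \<open>The layers of \<open>y\<close> lag one mesh behind those of \<open>x\<close>, so
    their telescoping sum starts at the level \<open>- e\<close>. That is where the extra multiple
    of \<open>u\<close> comes from.\<close>
  define s where "s j = inf y (q j - e)" for j
  have s: "inf y (q j) = s (Suc j)" for j by (simp add: s_def q)
  have "x = (\<Sum>j<N. inf x (q (Suc j)) - inf x (q j))"
    using assms by (subst sum_lessThan_telescope) (simp add: q0 qN inf_absorb1 inf_absorb2 del: diff_inf_eq_sup)
  also have "\<dots> \<le> (\<Sum>j<N. inf (pprt (x - q j)) (pprt (q j - y)) + (inf y (q j) - inf y (q j - e)))"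
    unfolding q by (intro sum_mono slice_le e)
  also have "\<dots> = (\<Sum>j<N. inf (pprt (x - q j)) (pprt (q j - y))) + (s N - s 0)"
    by (simp only: s s_def[symmetric] sum.distrib sum_lessThan_telescope)
  also have "s 0 = - e"
  proof -
    have "- e \<le> 0" using e by simp
    then have "- e \<le> y" using assms(3) by (rule order_trans)
    then show ?thesis by (simp add: s_def q0 inf_absorb2)
  qed
  also have "s N \<le> y" by (simp add: s_def)
  finally show ?thesis
    by (simp add: q_def e_def algebra_simps)
qed

section \<open>Order continuous norms\<close>

text \<open>Order continuity is applied to the differences between upper bounds and terms of
  \<open>x\<close>. If \<open>l\<close> lies below all of them, subtracting \<open>l\<close> from an
  upper bound leaves an upper bound, so \<open>u - k l\<close> is one for every \<open>k\<close>,
  and the Archimedean property gives \<open>l \<le> 0\<close>. Small differences then make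
  \<open>x\<close> Cauchy.\<close>

lemma order_continuous_incseq_convergent:
  fixes x :: "nat \<Rightarrow> 'a::banach_lattice"
  assumes ocn: "order_continuous_norm TYPE('a)" and inc: "incseq x" and le: "\<And>n. x n \<le> u"
  shows "convergent x"
proof -
  define B where "B = {y. \<forall>n. x n \<le> y}"
  define D where "D = {y - x n | y n. y \<in> B}"
  have ne: "D \<noteq> {}" using le by (auto simp: D_def B_def)
  have dir: "\<exists>z\<in>D. z \<le> a \<and> z \<le> b" if ab: "a \<in> D" "b \<in> D" for a b
  proof -
    obtain y n where a: "a = y - x n" "y \<in> B" using ab(1) by (auto simp: D_def)
    obtain y' m where b: "b = y' - x m" "y' \<in> B" using ab(2) by (auto simp: D_def)
    let ?z = "inf y y' - x (max n m)"
    have "inf y y' \<in> B" using a b by (auto simp: B_def)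
    then have "?z \<in> D" by (auto simp: D_def)
    moreover have "x n \<le> x (max n m)" "x m \<le> x (max n m)"
      using inc by (auto simp: incseq_def)
    then have "?z \<le> a" "?z \<le> b" unfolding a b by (auto intro!: diff_mono)
    ultimately show ?thesis by blast
  qed
  have pos: "0 \<le> z" if "z \<in> D" for z
    using that by (auto simp: D_def B_def)
  have glb: "l \<le> 0" if l: "\<forall>z\<in>D. l \<le> z" for l
  proof (rule archimedean_lattice)
    fix k :: nat
    have "u - of_nat k *\<^sub>R l \<in> B"
    proof (induction k)
      case 0
      then show ?case using le by (simp add: B_def)
    next
      case (Suc k)
      have "l \<le> u - of_nat k *\<^sub>R l - x n" for n
        using l Suc by (auto simp: D_def)
      then have "x n \<le> u - of_nat (Suc k) *\<^sub>R l" for n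
        by (simp add: algebra_simps)
      then show ?case by (simp add: B_def del: of_nat_Suc)
    qed
    then have "x 0 \<le> u - of_nat k *\<^sub>R l" by (simp add: B_def)
    then show "of_nat k *\<^sub>R l \<le> u - x 0" by (simp add: algebra_simps)
  qed
  have small: "\<forall>e>0. \<exists>d\<in>D. \<forall>z\<in>D. z \<le> d \<longrightarrow> norm z < e"
    by (rule ocn[unfolded order_continuous_norm_def, THEN spec, THEN mp])
      (use ne dir pos glb in \<open>simp\<close>)
  have "Cauchy x"
  proof (rule metric_CauchyI)
    fix e :: real assume "0 < e"
    then obtain d where d: "d \<in> D" "\<And>z. z \<in> D \<Longrightarrow> z \<le> d \<Longrightarrow> norm z < e / 2"
      using small[THEN spec, of "e / 2"] by auto
    then obtain y n where yn: "d = y - x n" "y \<in> B" by (auto simp: D_def)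
    have *: "norm (y - x m) < e / 2" if "m \<ge> n" for m
    proof (rule d(2))
      show "y - x m \<in> D" using yn by (auto simp: D_def)
      show "y - x m \<le> d" using inc that yn by (auto simp: incseq_def)
    qed
    have "dist (x m) (x m') < e" if "m \<ge> n" "m' \<ge> n" for m m'
    proof -
      have "dist (x m) (x m') \<le> norm (y - x m') + norm (y - x m)"
        using norm_triangle_ineq4[of "y - x m'" "y - x m"] by (simp add: dist_norm)
      then show ?thesis using *[OF that(1)] *[OF that(2)] by simp
    qed
    then show "\<exists>M. \<forall>m\<ge>M. \<forall>n\<ge>M. dist (x m) (x n) < e" by blast
  qed
  then show ?thesis by (rule Cauchy_convergent)
qed

text \<open>Sums of disjoint positive elements are suprema, so the partial sums stay below
  \<open>u\<close>. They increase, hence converge, and their successive differences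
  \<open>d n\<close> tend to 0.\<close>

lemma order_continuous_disjoint_tendsto_0:
  fixes d :: "nat \<Rightarrow> 'a::banach_lattice"
  assumes ocn: "order_continuous_norm TYPE('a)" and pos: "\<And>n. 0 \<le> d n" and le: "\<And>n. d n \<le> u"
    and disj: "\<And>m n. m \<noteq> n \<Longrightarrow> inf (d m) (d n) = 0"
  shows "d \<longlonglongrightarrow> 0"
proof -
  define s where "s n = (\<Sum>i<n. d i)" for n
  have s0: "0 \<le> s n" for n by (simp add: s_def sum_nonneg pos)
  have inf0: "inf (s n) (d m) = 0" if "n \<le> m" for n m
    using that
  proof (induction n)
    case 0
    then show ?case using pos by (simp add: s_def inf_absorb1)
  next
    case (Suc n)
    have "inf (s (Suc n)) (d m) \<le> inf (s n) (d m) + inf (d n) (d m)"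
      using inf_add_le[OF s0 pos pos] by (simp add: s_def)
    also have "\<dots> = 0" using Suc disj[of n m] by simp
    finally show ?case using s0 pos by (metis antisym le_infI)
  qed
  have "s n \<le> u" for n
  proof (induction n)
    case 0
    then show ?case using order_trans[OF pos le] by (simp add: s_def)
  next
    case (Suc n)
    have "s (Suc n) = sup (s n) (d n)"
      using add_eq_inf_sup[of "s n" "d n"] inf0[of n n] by (simp add: s_def)
    then show ?case using Suc le by simp
  qed
  moreover have "incseq s" by (intro incseq_SucI) (simp add: s_def pos)
  ultimately have "convergent s" using order_continuous_incseq_convergent[OF ocn] by blast
  then obtain l where l: "s \<longlonglongrightarrow> l" by (auto simp: convergent_def)
  have "(\<lambda>n. s (Suc n) - s n) \<longlonglongrightarrow> l - l"
    by (intro tendsto_diff LIMSEQ_Suc l)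
  then show ?thesis by (simp add: s_def)
qed

section \<open>Almost order boundedness of L-weakly compact sequences\<close>

lemma L_weakly_compact_almost_order_bounded:
  fixes y :: "nat \<Rightarrow> 'a::banach_lattice"
  assumes lw: "L_weakly_compact (range y)" and e: "0 < e"
  shows "\<exists>u\<ge>0. \<forall>k. norm (pprt (\<bar>y k\<bar> - u)) \<le> e"
proof (rule ccontr)
  \<comment> \<open>Choose terms far above large multiples of the sum of the previous ones. Subtracting that
    multiple and a small multiple of a weighted sum \<open>w\<close> of all chosen terms makes them disjoint.\<close>
  assume "\<not> ?thesis"
  then have "\<forall>u. \<exists>k. 0 \<le> u \<longrightarrow> e < norm (pprt (\<bar>y k\<bar> - u))" by (meson not_le)
  then obtain K where K: "\<And>u. 0 \<le> u \<Longrightarrow> e < norm (pprt (\<bar>y (K u)\<bar> - u))" by metis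
  \<comment> \<open>\<open>S m\<close> is the sum of the terms \<open>a i\<close> with
    \<open>i < m\<close>, and \<open>a m\<close> is the term that exceeds \<open>4 ^ m\<close> times
    this sum by more than \<open>e\<close> in norm. The growth rate 4 offsets two factors 1/2, one
    from the weights in \<open>w\<close> and one from the multiple of \<open>w\<close> that is
    subtracted.\<close>
  define S where "S = rec_nat 0 (\<lambda>m s. s + \<bar>y (K (4 ^ m *\<^sub>R s))\<bar>)"
  define a where "a m = \<bar>y (K (4 ^ m *\<^sub>R S m))\<bar>" for m
  have S_Suc: "S (Suc m) = S m + a m" and S_0: "S 0 = 0" for m
    by (simp_all add: S_def a_def)
  have a0: "0 \<le> a m" for m by (simp add: a_def)
  have S: "S m = (\<Sum>i<m. a i)" for m
    by (induction m) (simp_all add: S_0 S_Suc)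
  have S0: "0 \<le> S m" for m by (simp add: S sum_nonneg a0)
  have big: "e < norm (pprt (a m - 4 ^ m *\<^sub>R S m))" for m
    unfolding a_def using S0 by (intro K scaleR_nonneg_nonneg) simp_all
  obtain B where B: "\<And>k. norm (y k) \<le> B"
    using lw by (auto simp: L_weakly_compact_def bounded_iff)
  have "summable (\<lambda>i. norm ((1/2) ^ i *\<^sub>R a i))"
  proof (rule summable_comparison_test')
    show "summable (\<lambda>i. (1/2) ^ i * B)" by (intro summable_mult2 summable_geometric) simp
    show "norm (norm ((1/2) ^ n *\<^sub>R a n)) \<le> (1/2) ^ n * B" if "0 \<le> n" for n
      using B by (simp add: a_def norm_abs_lattice mult_left_mono)
  qed
  then have sm: "summable (\<lambda>i. (1/2) ^ i *\<^sub>R a i)" by (rule summable_norm_cancel)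
  define w where "w = (\<Sum>i. (1/2) ^ i *\<^sub>R a i)"
  have lim: "(\<lambda>n. \<Sum>i<n. (1/2) ^ i *\<^sub>R a i) \<longlonglongrightarrow> w"
    using sm by (simp add: w_def summable_LIMSEQ)
  have w: "(1/2) ^ i *\<^sub>R a i \<le> w" for i
  proof (rule lim_mono_lattice[OF tendsto_const LIMSEQ_ignore_initial_segment[OF lim, of "Suc i"]])
    fix n
    have "(\<Sum>j\<in>{i}. (1/2) ^ j *\<^sub>R a j) \<le> (\<Sum>j<n + Suc i. (1/2) ^ j *\<^sub>R a j)"
      by (intro sum_mono2) (auto intro!: scaleR_nonneg_nonneg a0)
    then show "(1/2) ^ i *\<^sub>R a i \<le> (\<Sum>j<n + Suc i. (1/2) ^ j *\<^sub>R a j)" by simp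
  qed
  have w0: "0 \<le> w" using order_trans[OF _ w[of 0]] a0[of 0] by simp
  define v where "v m = pprt (a m - 4 ^ m *\<^sub>R S m - (1/2) ^ m *\<^sub>R w)" for m
  have v0: "0 \<le> v m" for m by (simp add: v_def)
  have disj: "inf (v m) (v l) = 0" if "m < l" for m l
  proof (rule inf_zero_mono[OF _ v0 _ v0])
    \<comment> \<open>As \<open>w\<close> dominates \<open>a l\<close> with weight
      \<open>(1/2) ^ l\<close>, the multiple of \<open>w\<close> subtracted in \<open>v m\<close>
      dominates \<open>c\<close> times \<open>a l\<close>. Since \<open>m < l\<close> gives
      \<open>1 \<le> c * 4 ^ l\<close>, \<open>v m\<close> and \<open>v l\<close> lie below
      multiples of the positive and negative parts of the same element \<open>?b\<close>.\<close>
    define c :: real where "c = (1/2) ^ m * (1/2) ^ l"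
    have c: "0 < c" by (simp add: c_def)
    let ?b = "4 ^ l *\<^sub>R a m - a l"
    have am: "a m \<le> S l"
      using sum_mono2[of "{..<l}" "{m}" a] that a0 by (simp add: S)
    have "inf (pprt (- ?b)) (pprt ?b) = 0"
      using inf_pprt_uminus[of "- ?b"] by (metis minus_minus)
    then have "inf (pprt (- ?b)) (c *\<^sub>R pprt ?b) = 0"
      using c by (intro inf_scaleR_zero) simp_all
    then show "inf (c *\<^sub>R pprt ?b) (pprt (- ?b)) = 0" by (simp only: inf_commute)
    have "a l - 4 ^ l *\<^sub>R S l - (1/2) ^ l *\<^sub>R w \<le> - ?b"
    proof -
      have "0 \<le> (1/2) ^ l *\<^sub>R w" using w0 by (simp add: scaleR_nonneg_nonneg)
      moreover have "4 ^ l *\<^sub>R a m \<le> 4 ^ l *\<^sub>R S l" using am by (simp add: scaleR_left_mono)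
      ultimately have "a l - 4 ^ l *\<^sub>R S l - (1/2) ^ l *\<^sub>R w \<le> a l - 4 ^ l *\<^sub>R a m - 0"
        by (intro diff_mono) simp_all
      then show ?thesis by simp
    qed
    then show "v l \<le> pprt (- ?b)" unfolding v_def by (rule pprt_mono)
    have "a m - 4 ^ m *\<^sub>R S m - (1/2) ^ m *\<^sub>R w \<le> c *\<^sub>R ?b"
    proof -
      have "c *\<^sub>R a l \<le> (1/2) ^ m *\<^sub>R w"
        using scaleR_left_mono[OF w[of l], of "(1/2) ^ m"] by (simp add: c_def)
      moreover have "0 \<le> 4 ^ m *\<^sub>R S m" using S0 by (simp add: scaleR_nonneg_nonneg)
      moreover have "a m \<le> (c * 4 ^ l) *\<^sub>R a m"
      proof -
        have "(1::real) = (1/2) ^ l * (1/2) ^ l * 4 ^ l"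
          by (simp add: power_mult_distrib[symmetric])
        also have "\<dots> \<le> c * 4 ^ l"
          unfolding c_def using that by (intro mult_right_mono power_decreasing) simp_all
        finally show ?thesis using scaleR_right_mono[OF _ a0] by fastforce
      qed
      ultimately have "a m - 4 ^ m *\<^sub>R S m - (1/2) ^ m *\<^sub>R w \<le> (c * 4 ^ l) *\<^sub>R a m - 0 - c *\<^sub>R a l"
        by (intro diff_mono)
      then show ?thesis by (simp add: scaleR_right_diff_distrib)
    qed
    then show "v m \<le> c *\<^sub>R pprt ?b"
      unfolding v_def using c pprt_mono by (metis scaleR_pprt less_imp_le)
  qed
  have v_le: "v m \<le> a m" for m
  proof -
    have "a m - 4 ^ m *\<^sub>R S m - (1/2) ^ m *\<^sub>R w \<le> a m - 0 - 0"
      using S0 w0 by (intro diff_mono scaleR_nonneg_nonneg) simp_all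
    then show ?thesis unfolding v_def using a0 pprt_mono pprt_eq_id by (metis diff_zero)
  qed
  have "v \<longlonglongrightarrow> 0"
  proof -
    have "v m \<in> solid_hull (range y)" for m
      using v_le[of m] v0[of m] by (auto simp: solid_hull_def a_def)
    moreover have "lat_disjoint (v i) (v j)" if "i \<noteq> j" for i j
      using disj[of i j] disj[of j i] that v0
      by (auto simp: lat_disjoint_def inf_commute neq_iff)
    then have "disjoint_seq v" by (auto simp: disjoint_seq_def)
    ultimately show ?thesis using lw by (auto simp: L_weakly_compact_def)
  qed
  then have "(\<lambda>m. norm (v m) + (1/2) ^ m * norm w) \<longlonglongrightarrow> norm (0::'a) + 0 * norm w"
    by (intro tendsto_intros LIMSEQ_power_zero) simp_all
  \<comment> \<open>Subtracting the multiple of \<open>w\<close> changes the norm by an amount that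
    tends to 0, which contradicts the convergence of the disjoint sequence \<open>v\<close>.\<close>
  moreover have "e \<le> norm (v m) + (1/2) ^ m * norm w" for m
  proof -
    have "pprt (a m - 4 ^ m *\<^sub>R S m) \<le> v m + (1/2) ^ m *\<^sub>R w"
      unfolding v_def using w0 by (intro pprt_subadd scaleR_nonneg_nonneg) simp_all
    then have "norm (pprt (a m - 4 ^ m *\<^sub>R S m)) \<le> norm (v m + (1/2) ^ m *\<^sub>R w)"
      by (rule norm_mono_lattice[OF zero_le_pprt])
    also have "\<dots> \<le> norm (v m) + (1/2) ^ m * norm w"
      using norm_triangle_ineq[of "v m" "(1/2) ^ m *\<^sub>R w"] by simp
    finally show ?thesis using big[of m] by simp
  qed
  ultimately have "e \<le> norm (0::'a) + 0 * norm w"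
    using LIMSEQ_le_const by blast
  then show False using e by simp
qed

text \<open>Truncation to the order interval from \<open>- u\<close> to \<open>u\<close> turns
  almost order boundedness into approximation in norm by an order bounded sequence.\<close>

lemma truncate_abs_le:
  fixes y u :: "'a::banach_lattice"
  shows "\<bar>y - sup (inf y u) (- u)\<bar> \<le> pprt (\<bar>y\<bar> - u)"
proof (rule abs_leI)
  have p: "pprt (z - w) = z - inf w z" for z w :: 'a
    by (simp add: pprt_def add_sup_distrib_left sup.commute)
  have "y - sup (inf y u) (- u) \<le> y - inf u y"
    by (intro diff_left_mono) (simp add: inf.commute)
  also have "\<dots> = pprt (y - u)" by (simp only: p)
  also have "\<dots> \<le> pprt (\<bar>y\<bar> - u)" by (intro pprt_mono diff_right_mono abs_ge_self)
  finally show "y - sup (inf y u) (- u) \<le> pprt (\<bar>y\<bar> - u)" .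
  have "- y - u \<le> \<bar>y\<bar> - u" by (intro diff_right_mono abs_ge_minus_self)
  also have "\<dots> \<le> pprt (\<bar>y\<bar> - u)" by (simp add: pprt_def)
  finally have "- u - y \<le> pprt (\<bar>y\<bar> - u)" by (simp only: diff_conv_add_uminus add.commute)
  then have "- u \<le> pprt (\<bar>y\<bar> - u) + y" by (metis diff_le_eq)
  moreover have "inf y u \<le> pprt (\<bar>y\<bar> - u) + y"
    by (rule order_trans[of _ y]) simp_all
  ultimately have "sup (inf y u) (- u) \<le> pprt (\<bar>y\<bar> - u) + y" by simp
  then have "sup (inf y u) (- u) - y \<le> pprt (\<bar>y\<bar> - u)" by (simp only: diff_le_eq)
  then show "- (y - sup (inf y u) (- u)) \<le> pprt (\<bar>y\<bar> - u)" by (simp only: minus_diff_eq)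
qed

section \<open>The Hahn--Banach theorem\<close>

text \<open>Homogeneity is required only as an inequality for positive factors, which is easy to
  check for infima and suprema. Applying it to \<open>inverse c\<close> as well yields
  equality.\<close>

definition sublinear :: "('a::real_vector \<Rightarrow> real) \<Rightarrow> bool"
  where "sublinear p \<longleftrightarrow> (\<forall>x y. p (x + y) \<le> p x + p y) \<and> (\<forall>c x. 0 < c \<longrightarrow> p (c *\<^sub>R x) \<le> c * p x) \<and> p 0 = 0"

lemma sublinear_scale:
  assumes "sublinear p" "0 \<le> c"
  shows "p (c *\<^sub>R x) = c * p x"
proof (cases "c = 0")
  case True
  then show ?thesis using assms by (simp add: sublinear_def)
next
  case False
  then have c: "0 < c" using assms by simp
  then have "p (inverse c *\<^sub>R (c *\<^sub>R x)) \<le> inverse c * p (c *\<^sub>R x)"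
    using assms unfolding sublinear_def by (metis inverse_positive_iff_positive)
  then have "c * p x \<le> p (c *\<^sub>R x)" using c by (simp add: field_simps)
  then show ?thesis using assms c unfolding sublinear_def by (metis antisym)
qed

lemma sublinear_ge_uminus:
  assumes "sublinear p"
  shows "- p (- x) \<le> p x"
proof -
  have "p (x + - x) \<le> p x + p (- x)" using assms unfolding sublinear_def by blast
  then show ?thesis using assms by (simp add: sublinear_def)
qed

text \<open>This single construction shows both that minimal sublinear functionals are odd, hence linear,
  and that the linear minorant can be made to agree with \<open>p\<close> at a prescribed point.\<close>

lemma sublinear_shift:
  fixes p :: "'a::real_vector \<Rightarrow> real"
  assumes p: "sublinear p"
  shows "\<exists>q. sublinear q \<and> q \<le> p \<and> q (- v) \<le> - p v"
proof -
  \<comment> \<open>The value \<open>s = 0\<close> gives \<open>q \<le> p\<close>, and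
    \<open>s = 1\<close> gives the bound at \<open>- v\<close>. Subadditivity of \<open>p\<close>
    keeps the infimum over \<open>s\<close> finite.\<close>
  define g where "g x s = p (x + s *\<^sub>R v) - s * p v" for x and s :: real
  define q where "q x = (INF s\<in>{0..}. g x s)" for x
  have sub: "p (x + y) \<le> p x + p y" for x y using p by (simp add: sublinear_def)
  have lower: "- p (- x) \<le> g x s" if "0 \<le> s" for x s
    using sub[of "x + s *\<^sub>R v" "- x"] sublinear_scale[OF p that, of v] by (simp add: g_def)
  have bdd: "bdd_below (g x ` {0..})" for x
    using lower by (intro bdd_belowI2[of _ "- p (- x)"]) auto
  have le: "q x \<le> g x s" if "0 \<le> s" for x s
    unfolding q_def using bdd that by (intro cINF_lower) auto
  have ge: "c \<le> q x" if "\<And>s. 0 \<le> s \<Longrightarrow> c \<le> g x s" for c x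
    unfolding q_def using that by (intro cINF_greatest) auto
  have "sublinear q"
    unfolding sublinear_def
  proof (intro conjI allI impI)
    fix x y
    have *: "q (x + y) \<le> g x s + g y t" if "0 \<le> s" "0 \<le> t" for s t
    proof -
      have "q (x + y) \<le> g (x + y) (s + t)" using that by (intro le) simp
      also have "\<dots> \<le> g x s + g y t"
        using sub[of "x + s *\<^sub>R v" "y + t *\<^sub>R v"] by (simp add: g_def algebra_simps)
      finally show ?thesis .
    qed
    have "q (x + y) - g y t \<le> q x" if "0 \<le> t" for t
      using *[OF _ that] by (intro ge) (simp add: algebra_simps)
    then have "q (x + y) - q x \<le> q y" by (intro ge) (simp add: algebra_simps)
    then show "q (x + y) \<le> q x + q y" by simp
  next
    fix c :: real and x assume c: "0 < c"
    have "q (c *\<^sub>R x) / c \<le> q x"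
    proof (rule ge)
      fix s :: real assume s: "0 \<le> s"
      have "q (c *\<^sub>R x) \<le> g (c *\<^sub>R x) (c * s)" using c s by (intro le) simp
      also have "\<dots> = c * g x s"
        using sublinear_scale[OF p, of c "x + s *\<^sub>R v"] c
        by (simp add: g_def algebra_simps)
      finally show "q (c *\<^sub>R x) / c \<le> g x s" using c by (simp add: field_simps)
    qed
    then show "q (c *\<^sub>R x) \<le> c * q x" using c by (simp add: field_simps)
  next
    have z: "g 0 s = 0" if "0 \<le> s" for s
      using sublinear_scale[OF p that, of v] by (simp add: g_def)
    show "q 0 = 0" using le[of 0 0] ge[of 0 0] z by (intro antisym) simp_all
  qed
  moreover have "q \<le> p" using le[of 0] by (auto simp: le_fun_def g_def)
  moreover have "q (- v) \<le> - p v"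
    using le[of 1 "- v"] p by (simp add: g_def sublinear_def)
  ultimately show ?thesis by blast
qed

text \<open>Zorn's lemma applies because the pointwise infimum of a nonempty chain is again
  sublinear: it is bounded below by \<open>- p (- x)\<close>, and any two members of the chain
  dominate a common one.\<close>

lemma minimal_sublinear_exists:
  fixes p :: "'a::real_vector \<Rightarrow> real"
  assumes p: "sublinear p"
  shows "\<exists>q. sublinear q \<and> q \<le> p \<and> (\<forall>r. sublinear r \<and> r \<le> q \<longrightarrow> r = q)"
proof -
  define A where "A = {q. sublinear q \<and> q \<le> p}"
  have "\<exists>m\<in>A. \<forall>a\<in>A. a \<le> m \<longrightarrow> a = m"
  \<comment> \<open>The order is reversed, so that a maximal element is a minimal
    functional.\<close>
  proof (rule predicate_Zorn)
    show "partial_order_on A (relation_of (\<lambda>x y. y \<le> x) A)"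
      by (rule partial_order_on_relation_ofI) auto
  next
    fix C assume "C \<in> Chains (relation_of (\<lambda>x y. y \<le> x) A)"
    then have CA: "q \<in> A" and chain: "q \<le> r \<or> r \<le> q" if "q \<in> C" "r \<in> C" for q r
      using that by (auto simp: Chains_def relation_of_def)
    show "\<exists>u\<in>A. \<forall>a\<in>C. u \<le> a"
    proof (cases "C = {}")
      case True
      then show ?thesis using p by (auto simp: A_def)
    next
      case False
      define u where "u x = (INF q\<in>C. q x)" for x
      have slin: "sublinear q" and qp: "q x \<le> p x" if "q \<in> C" for q x
        using CA[OF that that] by (auto simp: A_def le_fun_def)
      have "- p (- x) \<le> q x" if "q \<in> C" for q x
        using sublinear_ge_uminus[OF slin[OF that], of x] qp[OF that, of "- x"] by linarith
      then have bdd: "bdd_below ((\<lambda>q. q x) ` C)" for x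
        by (intro bdd_belowI2[of _ "- p (- x)"]) auto
      have le: "u x \<le> q x" if "q \<in> C" for q x
        unfolding u_def using bdd that by (intro cINF_lower) auto
      have ge: "c \<le> u x" if "\<And>q. q \<in> C \<Longrightarrow> c \<le> q x" for c x
        unfolding u_def using that False by (intro cINF_greatest) auto
      have "sublinear u"
        unfolding sublinear_def
      proof (intro conjI allI impI)
        fix x y
        have *: "u (x + y) \<le> q x + r y" if qr: "q \<in> C" "r \<in> C" for q r
        proof -
          obtain m where m: "m \<in> C" "m \<le> q" "m \<le> r"
            using chain[OF qr] qr by (metis order_refl)
          have "u (x + y) \<le> m (x + y)" using m by (intro le)
          also have "\<dots> \<le> m x + m y" using slin[OF m(1)] by (simp add: sublinear_def)
          also have "\<dots> \<le> q x + r y" using m by (intro add_mono) (auto simp: le_fun_def)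
          finally show ?thesis .
        qed
        have "u (x + y) - r y \<le> u x" if "r \<in> C" for r
          using *[OF _ that] by (intro ge) (simp add: algebra_simps)
        then have "u (x + y) - u x \<le> u y" by (intro ge) (simp add: algebra_simps)
        then show "u (x + y) \<le> u x + u y" by simp
      next
        fix c :: real and x assume c: "0 < c"
        have "u (c *\<^sub>R x) / c \<le> u x"
        proof (rule ge)
          fix q assume q: "q \<in> C"
          have "u (c *\<^sub>R x) \<le> q (c *\<^sub>R x)" using q by (rule le)
          also have "\<dots> \<le> c * q x" using slin[OF q] c by (simp add: sublinear_def)
          finally show "u (c *\<^sub>R x) / c \<le> q x" using c by (simp add: field_simps)
        qed
        then show "u (c *\<^sub>R x) \<le> c * u x" using c by (simp add: field_simps)
      next
        have z: "q 0 = 0" if "q \<in> C" for q using slin[OF that] by (simp add: sublinear_def)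
        obtain q where q: "q \<in> C" using False by blast
        have "u 0 \<le> 0" using le[OF q, of 0] z[OF q] by simp
        moreover have "0 \<le> u 0" by (rule ge) (simp only: z)
        ultimately show "u 0 = 0" by (rule antisym)
      qed
      moreover have "u \<le> p"
      proof (rule le_funI)
        obtain q where q: "q \<in> C" using False by blast
        show "u x \<le> p x" for x using le[OF q, of x] qp[OF q, of x] by simp
      qed
      ultimately have "u \<in> A" by (simp add: A_def)
      then show ?thesis using le by (auto simp: le_fun_def)
    qed
  qed
  then show ?thesis by (auto simp: A_def intro: order_trans)
qed

text \<open>By minimality \<open>q\<close> equals its own shift along \<open>v\<close>, hence is
  odd. Subadditivity at \<open>x\<close>, \<open>y\<close> and at their negatives then gives
  additivity.\<close>

lemma minimal_sublinear_linear:
  assumes q: "sublinear q" and min: "\<And>r. sublinear r \<Longrightarrow> r \<le> q \<Longrightarrow> r = q"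
  shows "linear q"
proof -
  have odd: "q (- v) = - q v" for v
  proof -
    have "q (- v) \<le> - q v" using sublinear_shift[OF q, of v] min by metis
    then show ?thesis using sublinear_ge_uminus[OF q, of v] by linarith
  qed
  have sub: "q (x + y) \<le> q x + q y" for x y using q by (simp add: sublinear_def)
  show ?thesis
  proof (rule linearI)
    show "q (x + y) = q x + q y" for x y
      using sub[of x y] sub[of "- x" "- y"] odd[of x] odd[of y] odd[of "x + y"] by simp
    show "q (c *\<^sub>R x) = c *\<^sub>R q x" for c x
    proof (cases "0 \<le> c")
      case True
      then show ?thesis using sublinear_scale[OF q] by simp
    next
      case False
      then have "q ((- c) *\<^sub>R x) = - c * q x" by (intro sublinear_scale[OF q]) simp
      then show ?thesis using odd[of "c *\<^sub>R x"] by simp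
    qed
  qed
qed

text \<open>Shifting along \<open>t\<close> before minimising forces
  \<open>h (- t) \<le> - p t\<close>, which is the missing inequality
  \<open>p t \<le> h t\<close>.\<close>

theorem hahn_banach_sublinear:
  assumes p: "sublinear p"
  shows "\<exists>h. linear h \<and> (\<forall>x. h x \<le> p x) \<and> h t = p t"
proof -
  obtain p' where p': "sublinear p'" "p' \<le> p" "p' (- t) \<le> - p t"
    using sublinear_shift[OF p, of t] by auto
  obtain h where h: "sublinear h" "h \<le> p'" "\<And>r. sublinear r \<Longrightarrow> r \<le> h \<Longrightarrow> r = h"
    using minimal_sublinear_exists[OF p'(1)] by auto
  have lin: "linear h" using minimal_sublinear_linear h by blast
  have le: "h x \<le> p x" for x using h(2) p'(2) by (meson le_fun_def order_trans)
  have "h (- t) \<le> - p t" using h(2) p'(3) by (meson le_fun_def order_trans)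
  then have "h t = p t" using le[of t] linear_neg[OF lin, of t] by simp
  then show ?thesis using lin le by blast
qed

section \<open>Functionals carried by a band\<close>

text \<open>In a Dedekind complete lattice, \<open>band_norm u x\<close> is the norm of the projection of
  \<open>x\<close> onto the band generated by \<open>u\<close>, provided that the norm is order continuous.\<close>

definition band_norm :: "'a::banach_lattice \<Rightarrow> 'a \<Rightarrow> real"
  where "band_norm u x = (SUP k\<in>{0..}. norm (inf \<bar>x\<bar> (k *\<^sub>R \<bar>u\<bar>)))"

lemma band_norm_bdd: "bdd_above ((\<lambda>k. norm (inf \<bar>x\<bar> (k *\<^sub>R \<bar>u::'a::banach_lattice\<bar>))) ` {0..})"
proof (rule bdd_aboveI2)
  fix k :: real assume "k \<in> {0..}"
  then have "norm (inf \<bar>x\<bar> (k *\<^sub>R \<bar>u\<bar>)) \<le> norm \<bar>x\<bar>"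
    by (intro norm_mono_lattice) (simp_all add: scaleR_nonneg_nonneg)
  then show "norm (inf \<bar>x\<bar> (k *\<^sub>R \<bar>u\<bar>)) \<le> norm x" by (simp add: norm_abs_lattice)
qed

lemma band_norm_ge: "0 \<le> k \<Longrightarrow> norm (inf \<bar>x\<bar> (k *\<^sub>R \<bar>u\<bar>)) \<le> band_norm u (x::'a::banach_lattice)"
  unfolding band_norm_def using band_norm_bdd by (intro cSUP_upper) auto

lemma band_norm_least:
  fixes x u :: "'a::banach_lattice"
  assumes "\<And>k. 0 \<le> k \<Longrightarrow> norm (inf \<bar>x\<bar> (k *\<^sub>R \<bar>u\<bar>)) \<le> c"
  shows "band_norm u x \<le> c"
  unfolding band_norm_def using assms by (intro cSUP_least) auto

lemma band_norm_le_norm: "band_norm u x \<le> norm (x::'a::banach_lattice)"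
proof (rule band_norm_least)
  fix k :: real assume "0 \<le> k"
  then have "norm (inf \<bar>x\<bar> (k *\<^sub>R \<bar>u\<bar>)) \<le> norm \<bar>x\<bar>"
    by (intro norm_mono_lattice) (simp_all add: scaleR_nonneg_nonneg)
  then show "norm (inf \<bar>x\<bar> (k *\<^sub>R \<bar>u\<bar>)) \<le> norm x" by (simp add: norm_abs_lattice)
qed

lemma band_norm_uminus: "band_norm u (- x) = band_norm u x"
  by (simp add: band_norm_def)

text \<open>Subadditivity is inherited from \<open>inf_add_le\<close>; for homogeneity the factor is
  absorbed by replacing \<open>k\<close> with \<open>k / c\<close>.\<close>

lemma sublinear_band_norm: "sublinear (band_norm (u::'a::banach_lattice))"
  unfolding sublinear_def
proof (intro conjI allI impI)
  fix x y :: 'a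
  show "band_norm u (x + y) \<le> band_norm u x + band_norm u y"
  proof (rule band_norm_least)
    fix k :: real assume k: "0 \<le> k"
    then have ku: "0 \<le> k *\<^sub>R \<bar>u\<bar>" by (simp add: scaleR_nonneg_nonneg)
    have "inf \<bar>x + y\<bar> (k *\<^sub>R \<bar>u\<bar>) \<le> inf (\<bar>x\<bar> + \<bar>y\<bar>) (k *\<^sub>R \<bar>u\<bar>)"
      by (intro inf_mono abs_triangle_ineq order_refl)
    also have "\<dots> \<le> inf \<bar>x\<bar> (k *\<^sub>R \<bar>u\<bar>) + inf \<bar>y\<bar> (k *\<^sub>R \<bar>u\<bar>)"
      using ku by (intro inf_add_le) simp_all
    finally have "norm (inf \<bar>x + y\<bar> (k *\<^sub>R \<bar>u\<bar>)) \<le> norm (inf \<bar>x\<bar> (k *\<^sub>R \<bar>u\<bar>) + inf \<bar>y\<bar> (k *\<^sub>R \<bar>u\<bar>))"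
      using ku by (intro norm_mono_lattice) simp_all
    also have "\<dots> \<le> norm (inf \<bar>x\<bar> (k *\<^sub>R \<bar>u\<bar>)) + norm (inf \<bar>y\<bar> (k *\<^sub>R \<bar>u\<bar>))"
      by (rule norm_triangle_ineq)
    also have "\<dots> \<le> band_norm u x + band_norm u y"
      using k by (intro add_mono band_norm_ge)
    finally show "norm (inf \<bar>x + y\<bar> (k *\<^sub>R \<bar>u\<bar>)) \<le> band_norm u x + band_norm u y" .
  qed
next
  fix c :: real and x :: 'a assume c: "0 < c"
  show "band_norm u (c *\<^sub>R x) \<le> c * band_norm u x"
  proof (rule band_norm_least)
    fix k :: real assume k: "0 \<le> k"
    have "inf \<bar>c *\<^sub>R x\<bar> (k *\<^sub>R \<bar>u\<bar>) = c *\<^sub>R inf \<bar>x\<bar> ((k / c) *\<^sub>R \<bar>u\<bar>)"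
      using c by (simp add: scaleR_inf scaleR_abs)
    then show "norm (inf \<bar>c *\<^sub>R x\<bar> (k *\<^sub>R \<bar>u\<bar>)) \<le> c * band_norm u x"
      using c k band_norm_ge[of "k / c" x u] by simp
  qed
next
  show "band_norm u 0 = 0"
    using band_norm_le_norm[of u 0] band_norm_ge[of 0 0 u] by simp
qed

text \<open>A Hahn-Banach functional below \<open>band_norm u\<close> sees only the band of
  \<open>u\<close>. It is bounded because this seminorm is even and dominated by the norm.\<close>

lemma band_functional_exists:
  fixes u t :: "'a::banach_lattice"
  shows "\<exists>h::'a \<Rightarrow>\<^sub>L real. (\<forall>x. \<bar>h x\<bar> \<le> band_norm u x) \<and> h t = band_norm u t"
proof -
  obtain h where lin: "linear h" and le: "\<And>x. h x \<le> band_norm u x" and t: "h t = band_norm u t"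
    using hahn_banach_sublinear[OF sublinear_band_norm, of u t] by auto
  have abs: "\<bar>h x\<bar> \<le> band_norm u x" for x
    using le[of x] le[of "- x"] linear_neg[OF lin, of x] by (simp add: band_norm_uminus)
  have "bounded_linear h"
  proof (intro linear_conv_bounded_linear[THEN iffD1] bounded_linear_intro[of _ 1])
    show "norm (h x) \<le> norm x * 1" for x
      using order_trans[OF abs band_norm_le_norm] by simp
  qed (use lin in \<open>auto simp: linear_add linear_scale\<close>)
  then have "blinfun_apply (Blinfun h) = h" by (rule bounded_linear_Blinfun_apply)
  then show ?thesis using abs t by metis
qed

text \<open>Choose \<open>k n\<close> almost attaining the supremum in
  \<open>band_norm (u n) x\<close>. The corresponding infima are disjoint and lie below
  \<open>\<bar>x\<bar>\<close>, so they tend to 0 in norm.\<close>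

lemma band_norm_disjoint_tendsto_0:
  fixes u :: "nat \<Rightarrow> 'a::banach_lattice"
  assumes ocn: "order_continuous_norm TYPE('a)" and disj: "disjoint_seq u"
  shows "(\<lambda>n. band_norm (u n) x) \<longlonglongrightarrow> 0"
proof -
  have "\<exists>k\<ge>0. band_norm (u n) x \<le> norm (inf \<bar>x\<bar> (k *\<^sub>R \<bar>u n\<bar>)) + 1 / real (Suc n)" for n
  proof (rule ccontr)
    assume *: "\<not> ?thesis"
    have "band_norm (u n) x \<le> band_norm (u n) x - 1 / real (Suc n)"
    proof (rule band_norm_least)
      fix k :: real assume "0 \<le> k"
      then have "norm (inf \<bar>x\<bar> (k *\<^sub>R \<bar>u n\<bar>)) + 1 / real (Suc n) < band_norm (u n) x"
        using * by (meson not_le)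
      then show "norm (inf \<bar>x\<bar> (k *\<^sub>R \<bar>u n\<bar>)) \<le> band_norm (u n) x - 1 / real (Suc n)"
        by linarith
    qed
    then show False by simp
  qed
  then obtain k where k: "\<And>n. 0 \<le> k n"
    "\<And>n. band_norm (u n) x \<le> norm (inf \<bar>x\<bar> (k n *\<^sub>R \<bar>u n\<bar>)) + 1 / real (Suc n)"
    by metis
  define d where "d n = inf \<bar>x\<bar> (k n *\<^sub>R \<bar>u n\<bar>)" for n
  have ku: "0 \<le> k n *\<^sub>R \<bar>u n\<bar>" for n using k by (simp add: scaleR_nonneg_nonneg)
  have d0: "0 \<le> d n" for n using ku by (simp add: d_def)
  have "d \<longlonglongrightarrow> 0"
  proof (rule order_continuous_disjoint_tendsto_0[OF ocn d0])
    show "d n \<le> \<bar>x\<bar>" for n by (simp add: d_def)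
    fix m n :: nat assume "m \<noteq> n"
    then have "inf \<bar>u m\<bar> \<bar>u n\<bar> = 0" using disj by (auto simp: disjoint_seq_def lat_disjoint_def)
    then have "inf \<bar>u m\<bar> (k n *\<^sub>R \<bar>u n\<bar>) = 0" using k by (intro inf_scaleR_zero) simp_all
    then have "inf (k n *\<^sub>R \<bar>u n\<bar>) \<bar>u m\<bar> = 0" by (simp only: inf_commute)
    then have "inf (k n *\<^sub>R \<bar>u n\<bar>) (k m *\<^sub>R \<bar>u m\<bar>) = 0"
      using k ku by (intro inf_scaleR_zero) simp_all
    then have "inf (d n) (d m) = 0"
      by (rule inf_zero_mono) (simp_all add: d0, simp_all add: d_def)
    then show "inf (d m) (d n) = 0" by (simp only: inf_commute)
  qed
  then have "(\<lambda>n. norm (d n) + 1 / real (Suc n)) \<longlonglongrightarrow> 0 + 0"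
    by (intro tendsto_add tendsto_norm_zero LIMSEQ_Suc[OF lim_1_over_n])
  moreover have "0 \<le> band_norm (u n) x" for n
    by (rule order_trans[OF norm_ge_zero band_norm_ge[OF order_refl]])
  ultimately show ?thesis
    using k(2) by (intro tendsto_sandwich[OF _ _ tendsto_const, of 0 "\<lambda>n. band_norm (u n) x"]) (auto simp: d_def)
qed

section \<open>Weakly convergent subsequences from uniform convexity\<close>

text \<open>Choose a decreasing sequence of infinite sets \<open>f n\<close>, each nearly maximising
  \<open>I\<close> inside its predecessor. A diagonal set is almost contained in every
  \<open>f n\<close>, and \<open>I\<close> does not decrease on passing to an almost contained set,
  so no infinite subset of the diagonal set has a larger value.\<close>

lemma exhaustion_infinite_subsets:
  fixes I :: "nat set \<Rightarrow> real"
  assumes mono: "\<And>A B. infinite A \<Longrightarrow> infinite B \<Longrightarrow> finite (B - A) \<Longrightarrow> I A \<le> I B"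
    and bound: "\<And>A. infinite A \<Longrightarrow> I A \<le> M"
  shows "\<exists>A. infinite A \<and> (\<forall>B. infinite B \<and> B \<subseteq> A \<longrightarrow> I B \<le> I A)"
proof -
  have step: "\<exists>B. infinite B \<and> B \<subseteq> A \<and> (\<forall>C. infinite C \<and> C \<subseteq> A \<longrightarrow> I C \<le> I B + 1 / real (Suc n))"
    if A: "infinite A" for A n
  proof -
    let ?S = "I ` {B. infinite B \<and> B \<subseteq> A}"
    have ne: "?S \<noteq> {}" using A by blast
    have bdd: "bdd_above ?S" using bound by (intro bdd_aboveI[of _ M]) auto
    have "Sup ?S - 1 / real (Suc n) < Sup ?S" by simp
    then obtain b where b: "b \<in> ?S" "Sup ?S - 1 / real (Suc n) < b"
      using less_cSupE[OF _ ne] by blast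
    then obtain B where B: "infinite B" "B \<subseteq> A" "b = I B" by auto
    have "I C \<le> I B + 1 / real (Suc n)" if C: "infinite C" "C \<subseteq> A" for C
    proof -
      have "I C \<le> Sup ?S" using C bdd by (intro cSup_upper) auto
      then show ?thesis using b B by simp
    qed
    then show ?thesis using B by blast
  qed
  define P where "P n A \<longleftrightarrow> infinite A" for n :: nat and A :: "nat set"
  define Q where "Q n A B \<longleftrightarrow> B \<subseteq> A \<and> (\<forall>C. infinite C \<and> C \<subseteq> A \<longrightarrow> I C \<le> I B + 1 / real (Suc n))"
    for n A B
  have "\<exists>f. \<forall>n. P n (f n) \<and> Q n (f n) (f (Suc n))"
  proof (rule dependent_nat_choice)
    show "\<exists>A. P 0 A" using infinite_UNIV_nat by (auto simp: P_def)
    show "\<exists>B. P (Suc n) B \<and> Q n A B" if "P n A" for A n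
      using step[of A n] that by (auto simp: P_def Q_def)
  qed
  then obtain f where PQ: "\<And>n. P n (f n)" "\<And>n. Q n (f n) (f (Suc n))" by metis
  have f: "infinite (f n)" "f (Suc n) \<subseteq> f n"
    "infinite C \<Longrightarrow> C \<subseteq> f n \<Longrightarrow> I C \<le> I (f (Suc n)) + 1 / real (Suc n)" for n C
    using PQ[of n] by (auto simp: P_def Q_def)
  have "\<exists>a. \<forall>n. a n \<in> f n \<and> a n < a (Suc n)"
  proof (rule dependent_nat_choice)
    show "\<exists>a. a \<in> f 0" using f(1)[of 0] by (metis ex_in_conv finite.emptyI)
    show "\<exists>b. b \<in> f (Suc n) \<and> a < b" if "a \<in> f n" for a n
      using f(1)[of "Suc n"] by (auto simp: infinite_nat_iff_unbounded)
  qed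
  then obtain a where a: "\<And>n. a n \<in> f n" "\<And>n. a n < a (Suc n)" by blast
  have af: "a m \<in> f n" if "n \<le> m" for m n
    using a(1)[of m] lift_Suc_antimono_le[where f = f, OF f(2) that] by (rule subsetD[rotated])
  have inj: "inj a" using a(2) by (simp add: strict_mono_Suc_iff strict_mono_imp_inj_on)
  have fin: "finite (range a - f n)" for n
  proof (rule finite_subset)
    show "range a - f n \<subseteq> a ` {..<n}"
    proof
      fix y assume y: "y \<in> range a - f n"
      then obtain m where m: "y = a m" by blast
      then have "m < n" using af[of n m] y by (cases "n \<le> m") auto
      then show "y \<in> a ` {..<n}" using m by blast
    qed
  qed (intro finite_imageI finite_lessThan)
  have inf: "infinite (range a)" using inj by (rule range_inj_infinite)
  have "I B \<le> I (range a)" if B: "infinite B" "B \<subseteq> range a" for B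
  proof (rule field_le_epsilon)
    fix e :: real assume "0 < e"
    then obtain n where n: "1 / real (Suc n) < e" using nat_approx_posE by blast
    have "finite (B - f n)" using B by (intro finite_subset[OF _ fin[of n]]) blast
    then have Bf: "infinite (B \<inter> f n)"
      using B(1) by (metis Diff_Diff_Int finite_Diff2)
    have "finite (B \<inter> f n - B)" by (rule finite_subset[of _ "{}"]) auto
    with B(1) Bf have "I B \<le> I (B \<inter> f n)" by (rule mono)
    also have "\<dots> \<le> I (f (Suc n)) + 1 / real (Suc n)" using Bf by (intro f(3)) auto
    also have "I (f (Suc n)) \<le> I (range a)" by (intro mono f inf fin)
    finally show "I B \<le> I (range a) + e" using n by linarith
  qed
  then show ?thesis using inf by blast
qed

section \<open>Midpoint hulls and almost minimisers\<close>

text \<open>Only midpoints are taken, instead of all convex combinations, so that the hull stays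
  inside a countable set closed under midpoints. Closed half-spaces still contain the hull of any of
  their subsets.\<close>

inductive_set midpoint_hull :: "'a::real_vector set \<Rightarrow> 'a set" for S where
  base: "x \<in> S \<Longrightarrow> x \<in> midpoint_hull S"
| mid: "x \<in> midpoint_hull S \<Longrightarrow> y \<in> midpoint_hull S \<Longrightarrow> (1/2) *\<^sub>R (x + y) \<in> midpoint_hull S"

lemma midpoint_hull_mono: "S \<subseteq> S' \<Longrightarrow> midpoint_hull S \<subseteq> midpoint_hull S'"
proof
  fix x assume "x \<in> midpoint_hull S" and "S \<subseteq> S'"
  then show "x \<in> midpoint_hull S'"
    by induction (auto intro: midpoint_hull.intros)
qed

lemma midpoint_hull_subset:
  assumes "S \<subseteq> C" "\<And>x y. x \<in> C \<Longrightarrow> y \<in> C \<Longrightarrow> (1/2) *\<^sub>R (x + y) \<in> C"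
  shows "midpoint_hull S \<subseteq> C"
proof
  fix x assume "x \<in> midpoint_hull S"
  then show "x \<in> C" using assms by induction auto
qed

text \<open>For an infinite index set \<open>A\<close>, let \<open>I A\<close> be the limit of the infima of \<open>\<Phi>\<close> over the hulls
  of the tails of \<open>x\<close> along \<open>A\<close>. If \<open>A\<close> maximises \<open>I\<close> among its own infinite subsets, then by uniform
  convexity almost minimisers along any two infinite subsets of \<open>A\<close> converge to the same limit.\<close>

theorem weakly_convergent_subsequence:
  fixes x :: "nat \<Rightarrow> 'a::banach" and \<Phi> :: "'a \<Rightarrow> real"
  assumes xC: "\<And>n. x n \<in> C"
    and midC: "\<And>y z. y \<in> C \<Longrightarrow> z \<in> C \<Longrightarrow> (1/2) *\<^sub>R (y + z) \<in> C"
    and bound: "\<And>z. z \<in> C \<Longrightarrow> \<bar>\<Phi> z\<bar> \<le> M"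
    and convex: "\<And>e. 0 < e \<Longrightarrow> \<exists>d>0. \<forall>y\<in>C. \<forall>z\<in>C.
      \<Phi> y + \<Phi> z - 2 * \<Phi> ((1/2) *\<^sub>R (y + z)) < d \<longrightarrow> norm (y - z) < e"
  shows "\<exists>r l. strict_mono r \<and> (\<forall>f::'a \<Rightarrow>\<^sub>L real. (\<lambda>n. f (x (r n))) \<longlonglongrightarrow> f l)"
proof -
  define H where "H A n = midpoint_hull (x ` (A \<inter> {n..}))" for A and n :: nat
  have HC: "H A n \<subseteq> C" for A n
    unfolding H_def using xC midC by (intro midpoint_hull_subset) auto
  have H_mono: "H B m \<subseteq> H A n" if "B \<inter> {m..} \<subseteq> A \<inter> {n..}" for A B m n
    unfolding H_def using that by (intro midpoint_hull_mono image_mono)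
  have H_ne: "H A n \<noteq> {}" if A: "infinite A" for A n
  proof -
    obtain m where "m \<ge> n" "m \<in> A" using A by (auto simp: infinite_nat_iff_unbounded_le)
    then have "x m \<in> H A n" unfolding H_def by (intro midpoint_hull.base) auto
    then show ?thesis by blast
  qed
  \<comment> \<open>\<open>L A\<close> consists of the lower bounds of \<open>\<Phi>\<close> on some
    tail hull. The infima over tail hulls increase with \<open>n\<close>, so their limit is the
    supremum of \<open>L A\<close>.\<close>
  define L where "L A = {c. \<exists>n. \<forall>z\<in>H A n. c \<le> \<Phi> z}" for A
  define I where "I A = Sup (L A)" for A
  have L_ne: "L A \<noteq> {}" for A
  proof -
    have "- M \<le> \<Phi> z" if "z \<in> H A 0" for z using bound[of z] HC[of A 0] that by (auto simp: abs_le_iff)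
    then have "- M \<in> L A" by (auto simp: L_def)
    then show ?thesis by blast
  qed
  have L_le: "c \<le> M" if *: "infinite A" "c \<in> L A" for A c
  proof -
    obtain n where n: "\<forall>z\<in>H A n. c \<le> \<Phi> z" using *(2) by (auto simp: L_def)
    obtain z where "z \<in> H A n" using H_ne[OF *(1)] by blast
    then show ?thesis using n bound[of z] HC[of A n] by force
  qed
  have I_upper: "c \<le> I A" if "infinite A" "c \<in> L A" for A c
    unfolding I_def using that L_le by (intro cSup_upper bdd_aboveI[of _ M]) auto
  have I_lower: "c \<in> L A" if *: "c < I A" for A c
  proof -
    obtain b where "b \<in> L A" "c < b" using less_cSupE[OF *[unfolded I_def] L_ne] by blast
    then show ?thesis by (force simp: L_def)
  qed
  have "\<exists>A. infinite A \<and> (\<forall>B. infinite B \<and> B \<subseteq> A \<longrightarrow> I B \<le> I A)"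
  proof (rule exhaustion_infinite_subsets)
    show "I A \<le> M" if "infinite A" for A
      unfolding I_def using L_ne L_le that by (intro cSup_least) auto
    show "I A \<le> I B" if AB: "infinite A" "infinite B" "finite (B - A)" for A B
    proof -
      have "c \<in> L B" if c: "c \<in> L A" for c
      proof -
        obtain n where n: "\<forall>z\<in>H A n. c \<le> \<Phi> z" using c by (auto simp: L_def)
        obtain k where k: "\<And>i. i \<in> B - A \<Longrightarrow> i < k"
          using AB(3) by (meson finite_nat_set_iff_bounded)
        have "H B (max n k) \<subseteq> H A n" using k by (intro H_mono) force
        then show ?thesis using n by (auto simp: L_def)
      qed
      then show ?thesis unfolding I_def[of A] using I_upper[OF AB(2)] L_ne by (intro cSup_least) auto
    qed
  qed
  then obtain A where A: "infinite A" and max: "\<And>B. infinite B \<Longrightarrow> B \<subseteq> A \<Longrightarrow> I B \<le> I A" by blast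
  have close: "\<exists>d>0. \<exists>n. \<forall>y\<in>H A n. \<forall>z\<in>H A n. \<Phi> y < I A + d \<and> \<Phi> z < I A + d \<longrightarrow> norm (y - z) < e"
    if e: "0 < e" for e
  proof -
    obtain d where d: "0 < d" "\<And>y z. y \<in> C \<Longrightarrow> z \<in> C \<Longrightarrow>
      \<Phi> y + \<Phi> z - 2 * \<Phi> ((1/2) *\<^sub>R (y + z)) < d \<Longrightarrow> norm (y - z) < e"
      using convex[OF e] by blast
    \<comment> \<open>Two values less than \<open>d / 4\<close> above \<open>I A\<close>, and a
      midpoint value at most \<open>d / 4\<close> below it that is counted twice, give a defect less
      than \<open>d\<close>.\<close>
    have "I A - d / 4 \<in> L A" using d(1) by (intro I_lower) simp
    then obtain n where n: "\<And>z. z \<in> H A n \<Longrightarrow> I A - d / 4 \<le> \<Phi> z" by (auto simp: L_def)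
    have "norm (y - z) < e" if "y \<in> H A n" "z \<in> H A n" "\<Phi> y < I A + d / 4" "\<Phi> z < I A + d / 4" for y z
    proof (rule d(2))
      show "y \<in> C" "z \<in> C" using that HC by auto
      have "(1/2) *\<^sub>R (y + z) \<in> H A n"
        using that(1,2) unfolding H_def by (rule midpoint_hull.mid)
      then show "\<Phi> y + \<Phi> z - 2 * \<Phi> ((1/2) *\<^sub>R (y + z)) < d"
        using n[of "(1/2) *\<^sub>R (y + z)"] that(3,4) by linarith
    qed
    then show ?thesis using d(1) by (intro exI[of _ "d / 4"]) auto
  qed
  \<comment> \<open>If \<open>\<Phi>\<close> stayed above this value on a tail hull of
    \<open>B\<close>, then \<open>I B\<close> would exceed \<open>I A\<close>, against the
    maximality of \<open>A\<close>.\<close>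
  have approx: "\<exists>z\<in>H B n. \<Phi> z < I A + 1 / real (Suc n)" if B: "infinite B" "B \<subseteq> A" for B n
  proof (rule ccontr)
    assume "\<not> ?thesis"
    then have "I A + 1 / real (Suc n) \<in> L B" by (auto simp: L_def not_less)
    then have "I A + 1 / real (Suc n) \<le> I A" by (rule order_trans[OF I_upper[OF B(1)] max[OF B]])
    then show False by simp
  qed
  obtain z where z: "\<And>n. z n \<in> H A n" "\<And>n. \<Phi> (z n) < I A + 1 / real (Suc n)"
    using approx[OF A order_refl] by metis
  \<comment> \<open>The sequence \<open>w\<close> of almost minimisers is arbitrary:
    \<open>w = z\<close> gives the Cauchy property, and almost minimisers along a subset of
    \<open>A\<close> are seen to have the same limit.\<close>
  have near: "\<exists>N. \<forall>m\<ge>N. \<forall>n\<ge>N. norm (z m - w n) < e"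
    if e: "0 < e" and w: "\<And>n. w n \<in> H A n" "\<And>n. \<Phi> (w n) < I A + 1 / real (Suc n)" for e w
  proof -
    obtain d n where d: "0 < d"
      "\<And>y z. y \<in> H A n \<Longrightarrow> z \<in> H A n \<Longrightarrow> \<Phi> y < I A + d \<Longrightarrow> \<Phi> z < I A + d \<Longrightarrow> norm (y - z) < e"
      using close[OF e] by blast
    obtain k where k: "1 / real (Suc k) < d" using d(1) nat_approx_posE by blast
    have small: "1 / real (Suc m) < d" if "m \<ge> max n k" for m
    proof -
      have "1 / real (Suc m) \<le> 1 / real (Suc k)" using that by (intro divide_left_mono) auto
      then show ?thesis using k by linarith
    qed
    have sub: "H A m \<subseteq> H A n" if "m \<ge> max n k" for m using that by (intro H_mono) auto
    have "norm (z m - w m') < e" if m: "m \<ge> max n k" "m' \<ge> max n k" for m m'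
    proof (rule d(2))
      show "z m \<in> H A n" "w m' \<in> H A n" using z w sub m by blast+
      show "\<Phi> (z m) < I A + d" "\<Phi> (w m') < I A + d"
        using z(2)[of m] w(2)[of m'] small[OF m(1)] small[OF m(2)] by linarith+
    qed
    then show ?thesis by blast
  qed
  have "Cauchy z"
    unfolding Cauchy_def dist_norm using near[OF _ z] by blast
  then obtain l where l: "z \<longlonglongrightarrow> l" by (auto simp: Cauchy_convergent_iff convergent_def)
  \<comment> \<open>Almost minimisers along an infinite set of such indices would converge to
    \<open>l\<close>, although their hulls lie in the closed half-space where \<open>f\<close> is at
    least \<open>f l + e\<close>.\<close>
  have upper: "finite {m\<in>A. f l + e \<le> f (x m)}" if e: "0 < e" for f :: "'a \<Rightarrow>\<^sub>L real" and e
  proof (rule ccontr)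
    define B where "B = {m\<in>A. f l + e \<le> f (x m)}"
    assume "infinite {m\<in>A. f l + e \<le> f (x m)}"
    then have B: "infinite B" "B \<subseteq> A" by (auto simp: B_def)
    obtain w where w: "\<And>n. w n \<in> H B n" "\<And>n. \<Phi> (w n) < I A + 1 / real (Suc n)"
      using approx[OF B] by metis
    have wA: "w n \<in> H A n" for n using w(1) H_mono[of B n A n] B(2) by blast
    have "(\<lambda>n. z n - w n) \<longlonglongrightarrow> 0"
    proof (rule LIMSEQ_I)
      fix s :: real assume "0 < s"
      then show "\<exists>N. \<forall>n\<ge>N. norm (z n - w n - 0) < s" using near[OF _ wA w(2)] by (metis diff_zero)
    qed
    then have "(\<lambda>n. z n - (z n - w n)) \<longlonglongrightarrow> l - 0" by (intro tendsto_diff l)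
    then have "(\<lambda>n. f (w n)) \<longlonglongrightarrow> f l" by (intro blinfun.tendsto tendsto_const) simp
    moreover have "f l + e \<le> f (w n)" for n
    proof -
      have "H B n \<subseteq> {v. f l + e \<le> f v}"
        unfolding H_def
        by (intro midpoint_hull_subset) (auto simp: B_def blinfun.add_right blinfun.scaleR_right)
      then show ?thesis using w(1) by blast
    qed
    ultimately have "f l + e \<le> f l" using LIMSEQ_le_const by blast
    then show False using e by simp
  qed
  have "(\<lambda>n. f (x (enumerate A n))) \<longlonglongrightarrow> f l" for f :: "'a \<Rightarrow>\<^sub>L real"
  proof (rule tendstoI)
    fix e :: real assume e: "0 < e"
    let ?F = "{m\<in>A. f l + e \<le> f (x m)} \<union> {m\<in>A. (- f) l + e \<le> (- f) (x m)}"
    have inj: "inj (enumerate A)" using A by (simp add: strict_mono_enumerate strict_mono_imp_inj_on)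
    have "finite ?F" using upper[OF e] by blast
    then have "finite (enumerate A -` ?F)" using inj by (intro finite_vimageI)
    then have "eventually (\<lambda>n. n \<notin> enumerate A -` ?F) sequentially"
      by (simp add: eventually_cofinite cofinite_eq_sequentially[symmetric])
    then show "eventually (\<lambda>n. dist (f (x (enumerate A n))) (f l) < e) sequentially"
    proof eventually_elim
      case (elim n)
      then show ?case using enumerate_in_set[OF A, of n]
        by (auto simp: dist_real_def blinfun.minus_left)
    qed
  qed
  then show ?thesis using strict_mono_enumerate[OF A] by blast
qed

section \<open>Order intervals of order continuous Banach lattices\<close>

text \<open>Sum, with geometric weights, functionals norming the elements of \<open>V\<close>.
  Domination by the norm of the positive part, instead of the norm, makes these functionals
  positive.\<close>

lemma countable_strictly_positive_functional:
  fixes V :: "'a::banach_lattice set"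
  assumes V: "countable V" "V \<noteq> {}" and pos: "\<And>v. v \<in> V \<Longrightarrow> 0 \<le> v"
  shows "\<exists>\<mu>::'a \<Rightarrow> real. bounded_linear \<mu> \<and> (\<forall>x\<ge>0. 0 \<le> \<mu> x) \<and> (\<forall>v\<in>closure V. v \<noteq> 0 \<longrightarrow> 0 < \<mu> v)"
proof -
  define v where "v = from_nat_into V"
  have vV: "v n \<in> V" for n using V by (simp add: v_def from_nat_into)
  have "sublinear (\<lambda>x::'a. norm (pprt x))"
    unfolding sublinear_def
  proof (intro conjI allI impI)
    show "norm (pprt (x + y)) \<le> norm (pprt x) + norm (pprt y)" for x y :: 'a
      using norm_mono_lattice[OF zero_le_pprt pprt_add_le] norm_triangle_ineq order_trans by blast
  qed (simp_all add: scaleR_pprt)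
  from hahn_banach_sublinear[OF this]
  have "\<exists>h. linear h \<and> (\<forall>x. h x \<le> norm (pprt x)) \<and> h (v n) = norm (pprt (v n))" for n
    by blast
  then obtain h where lin: "\<And>n. linear (h n)" and le: "\<And>n x. h n x \<le> norm (pprt x)"
    and hv: "\<And>n. h n (v n) = norm (pprt (v n))"
    by metis
  have hv: "h n (v n) = norm (v n)" for n using hv[of n] pos[OF vV] by simp
  have h0: "0 \<le> h n x" if "0 \<le> x" for n x
    using le[of n "- x"] that by (simp add: linear_neg[OF lin])
  have habs: "\<bar>h n x\<bar> \<le> norm x" for n x
    using order_trans[OF le norm_pprt_le, of n x] order_trans[OF le norm_pprt_le, of n "- x"]
    by (simp add: linear_neg[OF lin])
  define \<mu> where "\<mu> x = (\<Sum>n. (1/2) ^ n * h n x)" for x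
  have geom: "(\<lambda>n. (1/2) ^ n * c) sums (2 * c)" for c :: real
    using sums_mult2[OF geometric_sums[of "1/2::real"], of c] by simp
  have bnd: "norm ((1/2) ^ n * h n x) \<le> (1/2) ^ n * norm x" for n x
    using habs[of n x] by (simp add: abs_mult)
  have sm: "summable (\<lambda>n. (1/2) ^ n * h n x)" for x
    using summable_comparison_test'[OF sums_summable[OF geom] bnd] by blast
  have "bounded_linear \<mu>"
  proof (rule bounded_linear_intro)
    show "\<mu> (x + y) = \<mu> x + \<mu> y" for x y
      unfolding \<mu>_def by (simp add: suminf_add[OF sm sm] linear_add[OF lin] distrib_left)
    show "\<mu> (c *\<^sub>R x) = c *\<^sub>R \<mu> x" for c x
      unfolding \<mu>_def using suminf_mult[OF sm, of c x] by (simp add: linear_scale[OF lin] mult_ac)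
    show "norm (\<mu> x) \<le> norm x * 2" for x
    proof -
      have "norm (\<mu> x) \<le> (\<Sum>n. (1/2) ^ n * norm x)"
        unfolding \<mu>_def by (intro norm_suminf_le bnd sums_summable[OF geom])
      then show ?thesis using sums_unique[OF geom, of "norm x"] by simp
    qed
  qed
  moreover have "0 \<le> \<mu> x" if "0 \<le> x" for x
    unfolding \<mu>_def using h0[OF that] by (intro suminf_nonneg sm) simp
  moreover have "0 < \<mu> w" if w: "w \<in> closure V" "w \<noteq> 0" for w
  proof -
    obtain y where y: "\<And>n. y n \<in> V" "y \<longlonglongrightarrow> w" using w(1) by (auto simp: closure_sequential)
    have w0: "0 \<le> w" using lim_nonneg_lattice[OF y(2)] pos y(1) by blast
    \<comment> \<open>Within half of \<open>norm w\<close>, the norm of \<open>v'\<close> exceeds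
      its distance from \<open>w\<close>; so the functional norming \<open>v'\<close> is positive at
      \<open>w\<close>.\<close>
    obtain v' where v': "v' \<in> V" "dist v' w < norm w / 2"
      using w by (metis closure_approachable half_gt_zero zero_less_norm_iff)
    obtain n where n: "v' = v n"
      using v'(1) V unfolding v_def by (metis from_nat_into_surj)
    have "h n (v n) \<le> h n w + norm (v n - w)"
      using habs[of n "v n - w"] by (simp add: linear_diff[OF lin])
    moreover have "norm w \<le> norm (v n) + norm (v n - w)"
      using norm_triangle_ineq2[of w "v n"] by (simp add: norm_minus_commute)
    ultimately have "0 < h n w" using v'(2) hv[of n] n by (simp add: dist_norm)
    then have "0 < (1/2) ^ n * h n w" by simp
    also have "\<dots> \<le> \<mu> w"
      unfolding \<mu>_def using sum_le_suminf[OF sm, of "{n}" w] h0[OF w0] by simp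
    finally show ?thesis .
  qed
  ultimately show ?thesis by blast
qed

text \<open>Otherwise there are \<open>w n\<close> with \<open>\<mu> (w n) < (1/2) ^ n\<close> and
  norms at least \<open>e\<close>. The suprema \<open>v n\<close> of their tails exist as norm
  limits and decrease to some \<open>l\<close> in the closure of \<open>C\<close> with
  \<open>\<mu> l = 0\<close>. So \<open>l = 0\<close>, although \<open>v n\<close> dominates
  \<open>w n\<close>.\<close>

lemma strictly_positive_functional_norm_small:
  fixes C :: "'a::banach_lattice set"
  assumes ocn: "order_continuous_norm TYPE('a)"
    and C: "\<And>x. x \<in> C \<Longrightarrow> 0 \<le> x \<and> x \<le> u" "\<And>x y. x \<in> C \<Longrightarrow> y \<in> C \<Longrightarrow> sup x y \<in> C"
    and lin: "bounded_linear \<mu>" and pos: "\<And>x. 0 \<le> x \<Longrightarrow> (0::real) \<le> \<mu> x"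
    and strict: "\<And>v. v \<in> closure C \<Longrightarrow> v \<noteq> 0 \<Longrightarrow> 0 < \<mu> v"
    and e: "0 < e"
  shows "\<exists>d>0. \<forall>w\<in>C. \<mu> w < d \<longrightarrow> norm w < e"
proof (rule ccontr)
  assume "\<not> ?thesis"
  then have "\<exists>w\<in>C. \<mu> w < (1/2) ^ n \<and> e \<le> norm w" for n :: nat
    by (metis not_le zero_less_power half_gt_zero zero_less_one)
  then obtain w where w: "\<And>n. w n \<in> C" "\<And>n. \<mu> (w n) < (1/2) ^ n" "\<And>n. e \<le> norm (w n)"
    by metis
  interpret \<mu>: bounded_linear \<mu> by (rule lin)
  have \<mu>_mono: "\<mu> x \<le> \<mu> y" if "x \<le> y" for x y
    using pos[of "y - x"] that by (simp add: \<mu>.diff)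
  define s where "s n = rec_nat (w n) (\<lambda>m x. sup x (w (n + m + 1)))" for n
  have s_0: "s n 0 = w n" and s_Suc: "s n (Suc m) = sup (s n m) (w (n + m + 1))" for n m
    by (simp_all add: s_def)
  have sC: "s n m \<in> C" for n m by (induction m) (simp_all add: s_0 s_Suc w C(2))
  \<comment> \<open>The factor \<open>2 - (1/2) ^ m\<close> is the sum of the powers of 1/2 with
    exponents from 0 to \<open>m\<close>.\<close>
  have s\<mu>: "\<mu> (s n m) \<le> (1/2) ^ n * (2 - (1/2) ^ m)" for n m
  proof (induction m)
    case 0
    then show ?case using w(2)[of n] by (simp add: s_0)
  next
    case (Suc m)
    have "sup (s n m) (w (n + m + 1)) \<le> s n m + w (n + m + 1)"
      using C(1)[OF sC[of n m]] C(1)[OF w(1)[of "n + m + 1"]] by simp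
    then have "\<mu> (s n (Suc m)) \<le> \<mu> (s n m) + \<mu> (w (n + m + 1))"
      unfolding s_Suc using \<mu>_mono \<mu>.add by metis
    also have "\<dots> \<le> (1/2) ^ n * (2 - (1/2) ^ m) + (1/2) ^ (n + m + 1)"
      using Suc w(2)[of "n + m + 1"] by linarith
    also have "\<dots> = (1/2) ^ n * (2 - (1/2) ^ Suc m)"
      by (simp add: power_add algebra_simps)
    finally show ?case .
  qed
  have s_shift: "s (Suc n) m \<le> s n (Suc m)" for n m
  proof (induction m)
    case 0
    then show ?case by (simp add: s_0 s_Suc)
  next
    case (Suc m)
    then show ?case using sup_mono[OF Suc order_refl[of "w (n + Suc m + 1)"]]
      by (simp only: s_Suc[of n "Suc m"] s_Suc[of "Suc n" m]) simp
  qed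
  have "convergent (s n)" for n
  proof (rule order_continuous_incseq_convergent[OF ocn])
    show "incseq (s n)" by (intro incseq_SucI) (simp add: s_Suc)
    show "s n m \<le> u" for m using C(1)[OF sC] by blast
  qed
  then obtain v where v: "\<And>n. s n \<longlonglongrightarrow> v n" unfolding convergent_def by metis
  have wv: "w n \<le> v n" for n
  proof (rule lim_mono_lattice[OF tendsto_const v])
    show "w n \<le> s n m" for m by (induction m) (simp_all add: s_0 s_Suc le_supI1)
  qed
  have v_Suc: "v (Suc n) \<le> v n" for n
    using lim_mono_lattice[OF v LIMSEQ_Suc[OF v]] s_shift by blast
  have vC: "v n \<in> closure C" for n using v sC by (auto simp: closure_sequential)
  have v0: "0 \<le> v n" for n using lim_nonneg_lattice[OF v] C(1)[OF sC] by blast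
  have "\<mu> (v n) \<le> (1/2) ^ n * (2 - 0)" for n
    by (rule LIMSEQ_le[OF \<mu>.tendsto[OF v]
          tendsto_mult[OF tendsto_const tendsto_diff[OF tendsto_const LIMSEQ_power_zero]]])
      (use s\<mu> in auto)
  then have v\<mu>: "\<mu> (v n) \<le> (1/2) ^ n * 2" for n by simp
  have "convergent (\<lambda>n. - v n)"
    by (rule order_continuous_incseq_convergent[OF ocn, of _ 0])
      (auto intro!: incseq_SucI v_Suc simp: v0)
  then obtain l where l: "v \<longlonglongrightarrow> l"
    using convergent_minus_iff[of v] by (auto simp: convergent_def)
  have "l \<in> closure (closure C)" using l vC unfolding closure_sequential[of _ "closure C"] by blast
  then have lC: "l \<in> closure C" by simp
  have "\<mu> l \<le> 0 * 2"
    by (rule LIMSEQ_le[OF \<mu>.tendsto[OF l] tendsto_mult[OF LIMSEQ_power_zero tendsto_const]])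
      (use v\<mu> in auto)
  then have "l = 0" using strict[OF lC] by fastforce
  then have "(\<lambda>n. norm (v n)) \<longlonglongrightarrow> 0" using l by (simp add: tendsto_norm_zero)
  moreover have "e \<le> norm (v n)" for n
    using w(3)[of n] norm_mono_lattice[OF _ wv[of n]] C(1)[OF w(1)[of n]] by linarith
  ultimately have "e \<le> 0" using LIMSEQ_le_const by blast
  then show False using e by simp
qed

section \<open>A uniformly convex functional on an order interval\<close>

text \<open>For a space of functions, \<open>\<Phi> x\<close> is the \<open>\<mu>\<close>-integral of \<open>\<psi> (x / u)\<close>, where
  \<open>\<psi> t = (\<Sum>n. (1/2) ^ n * \<bar>t - q n\<bar>)\<close> is strictly convex because \<open>q\<close> is dense in the unit interval.\<close>

lemma uniformly_convex_functional_exists: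
  fixes u :: "'a::banach_lattice" and \<mu> :: "'a \<Rightarrow> real"
  assumes u: "0 \<le> u" and lin: "linear \<mu>" and pos: "\<And>x. 0 \<le> x \<Longrightarrow> 0 \<le> \<mu> x"
  shows "\<exists>(\<Phi>::'a \<Rightarrow> real) M. (\<forall>z. 0 \<le> z \<and> z \<le> u \<longrightarrow> \<bar>\<Phi> z\<bar> \<le> M) \<and>
    (\<forall>e>0. \<exists>d>0. \<forall>x y. 0 \<le> x \<and> x \<le> u \<and> 0 \<le> y \<and> y \<le> u \<and>
      \<Phi> x + \<Phi> y - 2 * \<Phi> ((1/2) *\<^sub>R (x + y)) < d \<longrightarrow> \<mu> \<bar>x - y\<bar> < e)"
proof -
  interpret \<mu>: linear \<mu> by (rule lin)
  have mono: "\<mu> x \<le> \<mu> y" if "x \<le> y" for x y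
    using pos[of "y - x"] that by (simp add: \<mu>.diff)
  define Q where "Q = \<rat> \<inter> {0..1::real}"
  have Q: "countable Q" "Q \<noteq> {}" by (auto simp: Q_def countable_rat intro!: exI[of _ 0])
  define q where "q = from_nat_into Q"
  have "q n \<in> Q" for n using Q by (simp add: q_def from_nat_into)
  then have q01: "0 \<le> q n" "q n \<le> 1" for n by (auto simp: Q_def)
  have q_surj: "\<exists>n. q n = real j / real N" if "j < N" for j N
  proof -
    have "real j / real N \<in> Q" using that by (simp add: Q_def)
    then show ?thesis using Q unfolding q_def by (metis from_nat_into_surj)
  qed
  have abs_le: "\<bar>z - q n *\<^sub>R u\<bar> \<le> u" if "0 \<le> z" "z \<le> u" for z n
  proof (rule abs_leI)
    have qu: "0 \<le> q n *\<^sub>R u" "q n *\<^sub>R u \<le> u"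
      using q01 u scaleR_right_mono[of "q n" 1 u] by (simp_all add: scaleR_nonneg_nonneg)
    show "z - q n *\<^sub>R u \<le> u" using diff_mono[OF that(2) qu(1)] by simp
    show "- (z - q n *\<^sub>R u) \<le> u" using diff_mono[OF qu(2) that(1)] by simp
  qed
  have geom: "(\<lambda>n. (1/2) ^ n * \<mu> u) sums (2 * \<mu> u)"
    using sums_mult2[OF geometric_sums[of "1/2::real"], of "\<mu> u"] by simp
  define \<Phi> where "\<Phi> z = (\<Sum>n. (1/2) ^ n * \<mu> \<bar>z - q n *\<^sub>R u\<bar>)" for z
  have bnd: "norm ((1/2) ^ n * \<mu> \<bar>z - q n *\<^sub>R u\<bar>) \<le> (1/2) ^ n * \<mu> u" if "0 \<le> z" "z \<le> u" for z n
    using mono[OF abs_le[OF that]] pos[OF abs_ge_zero] by (simp add: abs_mult)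
  have sm: "summable (\<lambda>n. (1/2) ^ n * \<mu> \<bar>z - q n *\<^sub>R u\<bar>)" if "0 \<le> z" "z \<le> u" for z
    using summable_comparison_test'[OF sums_summable[OF geom] bnd[OF that]] by blast
  have bound: "\<bar>\<Phi> z\<bar> \<le> 2 * \<mu> u" if "0 \<le> z" "z \<le> u" for z
  proof -
    have "norm (\<Phi> z) \<le> (\<Sum>n. (1/2) ^ n * \<mu> u)"
      unfolding \<Phi>_def by (intro norm_suminf_le bnd that sums_summable[OF geom])
    then show ?thesis using sums_unique[OF geom] by simp
  qed
  \<comment> \<open>The values of \<open>\<mu>\<close> at the triangle defects
    \<open>D n x y\<close>, with their weights, add up to the midpoint defect of
    \<open>\<Phi>\<close>. All of them are nonnegative, so a small total makes each one
    small.\<close>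
  define D where "D n x y = \<bar>x - q n *\<^sub>R u\<bar> + \<bar>y - q n *\<^sub>R u\<bar> - \<bar>(x - q n *\<^sub>R u) + (y - q n *\<^sub>R u)\<bar>" for n x y
  have D0: "0 \<le> D n x y" for n x y
    using abs_triangle_ineq[of "x - q n *\<^sub>R u" "y - q n *\<^sub>R u"] by (simp add: D_def)
  have D_sym: "D n x y = D n y x" for n x y by (simp add: D_def add.commute)
  have inf_le_D: "inf (pprt (x - q n *\<^sub>R u)) (pprt (q n *\<^sub>R u - y)) \<le> D n x y" for n x y
  proof -
    let ?i = "inf (pprt (x - q n *\<^sub>R u)) (pprt (q n *\<^sub>R u - y))"
    have "?i \<le> 2 *\<^sub>R ?i" by (simp add: scaleR_2)
    also have "\<dots> \<le> D n x y"
      using abs_add_defect[of "x - q n *\<^sub>R u" "y - q n *\<^sub>R u"] by (simp add: D_def)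
    finally show ?thesis .
  qed
  have defect: "(1/2) ^ n * \<mu> (D n x y) \<le> \<Phi> x + \<Phi> y - 2 * \<Phi> ((1/2) *\<^sub>R (x + y))"
    if xy: "0 \<le> x" "x \<le> u" "0 \<le> y" "y \<le> u" for n x y
  proof -
    let ?m = "(1/2) *\<^sub>R (x + y)"
    have m0: "0 \<le> ?m" using xy by (simp add: scaleR_nonneg_nonneg)
    have "(1/2) *\<^sub>R (x + y) \<le> (1/2) *\<^sub>R (u + u)" using xy by (intro scaleR_left_mono add_mono) simp_all
    then have mu: "?m \<le> u" by (simp flip: scaleR_2)
    have m: "2 *\<^sub>R \<bar>?m - q n *\<^sub>R u\<bar> = \<bar>(x - q n *\<^sub>R u) + (y - q n *\<^sub>R u)\<bar>" for n
    proof -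
      have "2 *\<^sub>R (?m - q n *\<^sub>R u) = (x - q n *\<^sub>R u) + (y - q n *\<^sub>R u)"
      proof -
        have "2 *\<^sub>R ?m = x + y" by simp
        then show ?thesis
          unfolding scaleR_right_diff_distrib[of 2] scaleR_2[of "q n *\<^sub>R u"] by (simp only: add_diff_add)
      qed
      then show ?thesis by (simp only: scaleR_abs[of 2, symmetric] zero_le_numeral)
    qed
    have t: "(1/2) ^ n * \<mu> (D n x y) = (1/2) ^ n * \<mu> \<bar>x - q n *\<^sub>R u\<bar> + (1/2) ^ n * \<mu> \<bar>y - q n *\<^sub>R u\<bar>
        - 2 * ((1/2) ^ n * \<mu> \<bar>?m - q n *\<^sub>R u\<bar>)" for n
      unfolding D_def m[symmetric] by (simp add: \<mu>.add \<mu>.diff \<mu>.scale algebra_simps)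
    have "(\<lambda>n. (1/2) ^ n * \<mu> (D n x y)) sums (\<Phi> x + \<Phi> y - 2 * \<Phi> ?m)"
      unfolding t \<Phi>_def using xy m0 mu
      by (intro sums_diff sums_add sums_mult summable_sums sm)
    then show ?thesis
      using sum_le_suminf[of "\<lambda>n. (1/2) ^ n * \<mu> (D n x y)" "{n}"] pos[OF D0]
      by (simp add: sums_iff)
  qed
  have convex: "\<exists>d>0. \<forall>x y. 0 \<le> x \<and> x \<le> u \<and> 0 \<le> y \<and> y \<le> u \<and>
      \<Phi> x + \<Phi> y - 2 * \<Phi> ((1/2) *\<^sub>R (x + y)) < d \<longrightarrow> \<mu> \<bar>x - y\<bar> < e" if e: "0 < e" for e
  proof -
    \<comment> \<open>The mesh of the grid accounts for less than \<open>e / 2\<close>; the other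
      half is left for finitely many triangle defects.\<close>
    obtain N where N: "0 < N" "\<mu> u / real N < e / 2"
    proof -
      obtain N where N: "\<mu> u / (e / 2) < real N" using reals_Archimedean2 by blast
      have "0 \<le> \<mu> u / (e / 2)" using pos[OF u] e by simp
      then have "0 < real N" using N by linarith
      then show ?thesis using N e that[of N] by (simp add: field_simps)
    qed
    define k where "k j = (SOME n. q n = real j / real N)" for j
    have k: "q (k j) = real j / real N" if "j < N" for j
      unfolding k_def using q_surj[OF that] by (rule someI_ex)
    define K where "K = (\<Sum>j<N. 2 ^ k j :: real)"
    have K0: "0 \<le> K" by (simp add: K_def sum_nonneg)
    \<comment> \<open>Undoing the weights of the \<open>N\<close> grid points multiplies
      \<open>d\<close> by \<open>K\<close>; the summand 1 keeps the denominator positive.\<close>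
    define d where "d = e / (2 * (K + 1))"
    have d: "0 < d" using e K0 by (simp add: d_def)
    have "\<mu> \<bar>x - y\<bar> < e"
      if xy: "0 \<le> x" "x \<le> u" "0 \<le> y" "y \<le> u" and small: "\<Phi> x + \<Phi> y - 2 * \<Phi> ((1/2) *\<^sub>R (x + y)) < d" for x y
    proof -
      let ?b = "\<lambda>x y. (1 / real N) *\<^sub>R u + (\<Sum>j<N. D (k j) x y)"
      have le: "x - y \<le> ?b x y" if "0 \<le> x" "x \<le> u" "0 \<le> y" for x y
      proof -
        have "(\<Sum>j<N. inf (pprt (x - (real j / real N) *\<^sub>R u)) (pprt ((real j / real N) *\<^sub>R u - y)))
            \<le> (\<Sum>j<N. D (k j) x y)"
          using inf_le_D k by (intro sum_mono) (metis lessThan_iff)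
        then show ?thesis using grid_le[OF that N(1)] by (meson add_left_mono order_trans)
      qed
      have "\<bar>x - y\<bar> \<le> ?b x y"
      proof (rule abs_leI)
        show "x - y \<le> ?b x y" using xy by (intro le)
        have "y - x \<le> ?b y x" using xy by (intro le)
        then show "- (x - y) \<le> ?b x y" by (simp add: D_sym[of _ y x])
      qed
      then have "\<mu> \<bar>x - y\<bar> \<le> \<mu> (?b x y)" by (rule mono)
      also have "\<dots> = \<mu> u / real N + (\<Sum>j<N. \<mu> (D (k j) x y))"
        by (simp add: \<mu>.add \<mu>.sum \<mu>.scale)
      also have "(\<Sum>j<N. \<mu> (D (k j) x y)) \<le> (\<Sum>j<N. 2 ^ k j * d)"
      proof (rule sum_mono)
        fix j
        have "(1/2) ^ k j * \<mu> (D (k j) x y) \<le> d" using defect[OF xy, of "k j"] small by linarith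
        then have "2 ^ k j * ((1/2) ^ k j * \<mu> (D (k j) x y)) \<le> 2 ^ k j * d"
          by (intro mult_left_mono) simp_all
        moreover have "2 ^ k j * ((1/2) ^ k j * c) = c" for c :: real
          by (simp add: power_divide)
        ultimately show "\<mu> (D (k j) x y) \<le> 2 ^ k j * d" by simp
      qed
      also have "\<dots> = K * d" by (simp add: K_def sum_distrib_right)
      also have "K * d \<le> e / 2" using e K0 by (simp add: d_def field_simps)
      finally show ?thesis using N(2) by linarith
    qed
    then show ?thesis using d by blast
  qed
  show ?thesis
  proof (rule exI[of _ \<Phi>], rule exI[of _ "2 * \<mu> u"], intro conjI allI impI)
    show "\<bar>\<Phi> z\<bar> \<le> 2 * \<mu> u" if "0 \<le> z \<and> z \<le> u" for z using that bound by simp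
  qed (rule convex)
qed

section \<open>Weak sequential compactness of order intervals\<close>

text \<open>Adjoin all values of the operations repeatedly. The stages increase, so two elements of
  the union lie in a common stage.\<close>

lemma countable_closed_superset:
  assumes "countable S" "countable G" "S \<subseteq> X"
    and "\<And>g x y. g \<in> G \<Longrightarrow> x \<in> X \<Longrightarrow> y \<in> X \<Longrightarrow> g x y \<in> X"
  shows "\<exists>C. countable C \<and> S \<subseteq> C \<and> C \<subseteq> X \<and> (\<forall>g\<in>G. \<forall>x\<in>C. \<forall>y\<in>C. g x y \<in> C)"
proof -
  define F where "F = rec_nat S (\<lambda>n A. A \<union> (\<Union>g\<in>G. \<Union>x\<in>A. g x ` A))"
  have F_0: "F 0 = S" and F_Suc: "F (Suc n) = F n \<union> (\<Union>g\<in>G. \<Union>x\<in>F n. g x ` F n)" for n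
    by (simp_all add: F_def)
  have "countable (F n)" for n
    by (induction n) (auto simp: F_0 F_Suc assms(1,2))
  moreover have "F n \<subseteq> X" for n
    by (induction n) (auto simp: F_0 F_Suc assms(4) subset_iff intro: assms(3)[THEN subsetD])
  moreover have "g x y \<in> (\<Union>n. F n)" if "g \<in> G" "x \<in> F m" "y \<in> F n" for g x y m n
  proof -
    have "incseq F" by (intro incseq_SucI) (auto simp: F_Suc)
    then have "x \<in> F (max m n)" "y \<in> F (max m n)"
      using that(2,3) by (meson incseqD max.cobounded1 max.cobounded2 subsetD)+
    then have "g x y \<in> F (Suc (max m n))" using that(1) by (auto simp: F_Suc)
    then show ?thesis by blast
  qed
  moreover have "S \<subseteq> (\<Union>n. F n)" using F_0 by blast
  ultimately show ?thesis
    by (intro exI[of _ "\<Union>n. F n"] conjI) auto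
qed

text \<open>Convexity of \<open>\<Phi>\<close> controls only \<open>\<mu> \<bar>y - z\<bar>\<close>.
  On a suitable countable set \<open>C\<close> that contains the sequence, smallness of
  \<open>\<mu>\<close> forces smallness in norm, so \<open>weakly_convergent_subsequence\<close>
  applies to \<open>C\<close>.\<close>

theorem order_interval_weakly_convergent_subsequence:
  fixes x :: "nat \<Rightarrow> 'a::banach_lattice"
  assumes ocn: "order_continuous_norm TYPE('a)" and x: "\<And>n. 0 \<le> x n" "\<And>n. x n \<le> u"
  shows "\<exists>r l. strict_mono r \<and> (\<forall>f::'a \<Rightarrow>\<^sub>L real. (\<lambda>n. f (x (r n))) \<longlonglongrightarrow> f l)"
proof -
  define X where "X = {z. 0 \<le> z \<and> z \<le> u}"
  define mid :: "'a \<Rightarrow> 'a \<Rightarrow> 'a" where "mid y z = (1/2) *\<^sub>R (y + z)" for y z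
  have mid: "mid y z \<in> X" if "y \<in> X" "z \<in> X" for y z
  proof -
    have "(1/2) *\<^sub>R (y + z) \<le> (1/2) *\<^sub>R (u + u)"
      using that by (intro scaleR_left_mono add_mono) (simp_all add: X_def)
    then show ?thesis using that by (simp add: X_def mid_def scaleR_nonneg_nonneg flip: scaleR_2)
  qed
  have absd: "\<bar>y - z\<bar> \<in> X" if "y \<in> X" "z \<in> X" for y z
  proof -
    have "y - z \<le> u - 0" "z - y \<le> u - 0" using that by (intro diff_mono; simp add: X_def)+
    then have "\<bar>y - z\<bar> \<le> u" by (intro abs_leI) simp_all
    then show ?thesis by (simp add: X_def)
  qed
  \<comment> \<open>Midpoints serve the hulls, suprema serve
    \<open>strictly_positive_functional_norm_small\<close>, and absolute differences are the
    elements at which \<open>\<mu>\<close> is compared with the norm.\<close>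
  have "\<exists>C. countable C \<and> range x \<subseteq> C \<and> C \<subseteq> X \<and>
      (\<forall>g\<in>{mid, sup, \<lambda>y z. \<bar>y - z\<bar>}. \<forall>y\<in>C. \<forall>z\<in>C. g y z \<in> C)"
  proof (rule countable_closed_superset)
    show "range x \<subseteq> X" using x by (auto simp: X_def)
    have "sup y z \<in> X" if "y \<in> X" "z \<in> X" for y z using that by (simp add: X_def le_supI1)
    then show "g y z \<in> X" if "g \<in> {mid, sup, \<lambda>y z. \<bar>y - z\<bar>}" "y \<in> X" "z \<in> X" for g y z
      using that mid absd by fastforce
  qed auto
  then obtain C where C: "countable C" "range x \<subseteq> C" "C \<subseteq> X"
    and ops: "\<forall>g\<in>{mid, sup, \<lambda>y z. \<bar>y - z\<bar>}. \<forall>y\<in>C. \<forall>z\<in>C. g y z \<in> C"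
    by blast
  have C_mid: "(1/2) *\<^sub>R (y + z) \<in> C" and C_sup: "sup y z \<in> C" and C_absd: "\<bar>y - z\<bar> \<in> C"
    if "y \<in> C" "z \<in> C" for y z
    using ops that by (simp_all add: mid_def)
  have CX: "0 \<le> z \<and> z \<le> u" if "z \<in> C" for z using that C(3) by (auto simp: X_def)
  have "C \<noteq> {}" using C(2) by blast
  from countable_strictly_positive_functional[OF C(1) this CX[THEN conjunct1]] obtain \<mu> where \<mu>: "bounded_linear \<mu>" "\<And>x. 0 \<le> x \<Longrightarrow> (0::real) \<le> \<mu> x"
    "\<And>v. v \<in> closure C \<Longrightarrow> v \<noteq> 0 \<Longrightarrow> 0 < \<mu> v"
    by blast
  have u: "0 \<le> u" using order_trans[OF x(1) x(2)] .
  obtain \<Phi> :: "'a \<Rightarrow> real" and M where \<Phi>_bound: "\<forall>z. 0 \<le> z \<and> z \<le> u \<longrightarrow> \<bar>\<Phi> z\<bar> \<le> M"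
    and \<Phi>_convex: "\<forall>e>0. \<exists>d>0. \<forall>x y. 0 \<le> x \<and> x \<le> u \<and> 0 \<le> y \<and> y \<le> u \<and>
      \<Phi> x + \<Phi> y - 2 * \<Phi> ((1/2) *\<^sub>R (x + y)) < d \<longrightarrow> \<mu> \<bar>x - y\<bar> < e"
    by (rule uniformly_convex_functional_exists[OF u bounded_linear.linear[OF \<mu>(1)], THEN exE])
      (erule \<mu>(2), elim exE conjE, rule that)
  show ?thesis
  proof (rule weakly_convergent_subsequence[of x C \<Phi> M])
    show "x n \<in> C" for n using C(2) by blast
    show "(1/2) *\<^sub>R (y + z) \<in> C" if "y \<in> C" "z \<in> C" for y z using that by (rule C_mid)
    show "\<bar>\<Phi> z\<bar> \<le> M" if "z \<in> C" for z using \<Phi>_bound CX[OF that] by simp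
    fix e :: real assume e: "0 < e"
    have "\<exists>d>0. \<forall>w\<in>C. \<mu> w < d \<longrightarrow> norm w < e"
      by (rule strictly_positive_functional_norm_small[OF ocn CX C_sup \<mu>(1) _ _ e]) (simp_all add: \<mu>)
    then obtain d' where d': "0 < d'" "\<And>w. w \<in> C \<Longrightarrow> \<mu> w < d' \<Longrightarrow> norm w < e"
      by blast
    obtain d where d: "0 < d" "\<forall>x y. 0 \<le> x \<and> x \<le> u \<and> 0 \<le> y \<and> y \<le> u \<and>
      \<Phi> x + \<Phi> y - 2 * \<Phi> ((1/2) *\<^sub>R (x + y)) < d \<longrightarrow> \<mu> \<bar>x - y\<bar> < d'"
      by (rule \<Phi>_convex[rule_format, OF d'(1), THEN exE]) (erule conjE, rule that)
    have "norm (y - z) < e" if "y \<in> C" "z \<in> C" "\<Phi> y + \<Phi> z - 2 * \<Phi> ((1/2) *\<^sub>R (y + z)) < d" for y z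
    proof -
      have "\<mu> \<bar>y - z\<bar> < d'" using d(2) CX[OF that(1)] CX[OF that(2)] that(3) by simp
      then show ?thesis using d'(2)[OF C_absd[OF that(1,2)]] by (simp only: norm_abs_lattice)
    qed
    then show "\<exists>d>0. \<forall>y\<in>C. \<forall>z\<in>C.
      \<Phi> y + \<Phi> z - 2 * \<Phi> ((1/2) *\<^sub>R (y + z)) < d \<longrightarrow> norm (y - z) < e"
      using d(1) by blast
  qed
qed

section \<open>Disjoint weak* Dunford--Pettis operators\<close>

lemma symmetric_order_interval_weakly_convergent_subsequence:
  fixes v :: "nat \<Rightarrow> 'a::banach_lattice"
  assumes ocn: "order_continuous_norm TYPE('a)" and v: "\<And>n. - u \<le> v n" "\<And>n. v n \<le> u"
  shows "\<exists>r l. strict_mono r \<and> weakly_null (\<lambda>n. v (r n) - l)"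
proof -
  have "0 \<le> v n + u" "v n + u \<le> u + u" for n
    using add_mono[OF v(1)[of n] order_refl[of u]] v(2)[of n] by simp_all
  then obtain r l where r: "strict_mono r" and l: "\<And>f::'a \<Rightarrow>\<^sub>L real. (\<lambda>n. f (v (r n) + u)) \<longlonglongrightarrow> f l"
    using order_interval_weakly_convergent_subsequence[OF ocn, of "\<lambda>n. v n + u" "u + u"] by metis
  have "(\<lambda>n. f (v (r n) - (l - u))) \<longlonglongrightarrow> 0" for f :: "'a \<Rightarrow>\<^sub>L real"
    using LIM_zero[OF l[of f]] by (simp add: blinfun.add_right blinfun.diff_right algebra_simps)
  then show ?thesis using r unfolding weakly_null_def by blast
qed

lemma weak_star_null_subseq:
  assumes "weak_star_null h" "strict_mono r"
  shows "weak_star_null (h \<circ> r)"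
  using assms LIMSEQ_subseq_LIMSEQ by (fastforce simp: weak_star_null_def comp_def)

lemma weakly_null_blinfun:
  fixes T :: "'a::real_normed_vector \<Rightarrow>\<^sub>L 'b::real_normed_vector"
  assumes "weakly_null x"
  shows "weakly_null (\<lambda>n. T (x n))"
  unfolding weakly_null_def
proof
  fix f :: "'b \<Rightarrow>\<^sub>L real"
  show "(\<lambda>n. f (T (x n))) \<longlonglongrightarrow> 0"
    using assms[unfolded weakly_null_def, THEN spec, of "f o\<^sub>L T"] by simp
qed

text \<open>With \<open>l\<close> the weak limit of a subsequence of \<open>v\<close>, the DP*
  property handles the images of \<open>v (r n) - l\<close>, and weak* nullity handles the fixed
  vector \<open>T l\<close>.\<close>

lemma weak_star_null_order_bounded:
  fixes T :: "'e::banach_lattice \<Rightarrow>\<^sub>L 'f::banach_lattice"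
  assumes ocn: "order_continuous_norm TYPE('e)" and dp: "DP_star_property TYPE('f)"
    and h: "weak_star_null h" and v: "\<And>n. - u \<le> v n" "\<And>n. v n \<le> u"
  shows "\<exists>r. strict_mono r \<and> (\<lambda>n. h (r n) (T (v (r n)))) \<longlonglongrightarrow> 0"
proof -
  obtain r l where r: "strict_mono r" and wn: "weakly_null (\<lambda>n. v (r n) - l)"
    using symmetric_order_interval_weakly_convergent_subsequence[where v = v, OF ocn v] by blast
  have h': "weak_star_null (h \<circ> r)" using h r by (rule weak_star_null_subseq)
  have "(\<lambda>n. (h \<circ> r) n (T (v (r n) - l))) \<longlonglongrightarrow> 0"
    using dp weakly_null_blinfun[OF wn] h' unfolding DP_star_property_def by blast
  moreover have "(\<lambda>n. (h \<circ> r) n (T l)) \<longlonglongrightarrow> 0" using h' by (simp only: weak_star_null_def)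
  ultimately have "(\<lambda>n. (h \<circ> r) n (T (v (r n) - l)) + (h \<circ> r) n (T l)) \<longlonglongrightarrow> 0 + 0" by (rule tendsto_add)
  then have "(\<lambda>n. h (r n) (T (v (r n)))) \<longlonglongrightarrow> 0"
    by (simp add: blinfun.diff_right)
  then show ?thesis using r by blast
qed

text \<open>Split a subsequence of \<open>x\<close> into \<open>y + z\<close> and truncate
  \<open>y\<close> to an order bounded \<open>v\<close>. The remainder \<open>y - v\<close>
  contributes at most \<open>e / 2\<close>, while \<open>v\<close> and \<open>z\<close> contribute
  nothing in the limit along a further subsequence.\<close>

lemma weak_star_null_disjoint_wDP:
  fixes T :: "'e::banach_lattice \<Rightarrow>\<^sub>L 'f::banach_lattice"
  assumes ssp: "subsequence_splitting_property TYPE('e)" and dp: "DP_star_property TYPE('f)"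
    and T: "disjoint_weak_star_DP T"
    and h: "weak_star_null h" "\<And>n y. \<bar>h n y\<bar> \<le> norm y" and x: "bounded (range x)"
    and e: "0 < e"
  shows "\<exists>n. h n (T (x n)) < e"
proof (rule ccontr)
  assume "\<not> ?thesis"
  then have ge: "e \<le> h n (T (x n))" for n by (simp add: not_less)
  have ocn: "order_continuous_norm TYPE('e)"
    using ssp by (simp add: subsequence_splitting_property_def)
  obtain r y z where r: "strict_mono r" and xr: "\<And>k. x (r k) = y k + z k"
    and y: "L_weakly_compact (range y)" and z: "disjoint_seq z"
    using ssp x unfolding subsequence_splitting_property_def by blast
  define g where "g = h \<circ> r"
  have g: "weak_star_null g" unfolding g_def using h(1) r by (rule weak_star_null_subseq)
  have g_le: "\<bar>g k w\<bar> \<le> norm w" for k w by (simp add: g_def h(2))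
  have "bounded (range z)"
  proof -
    obtain A where A: "norm (x n) \<le> A" for n using x by (auto simp: bounded_iff)
    obtain B where B: "norm (y k) \<le> B" for k using y by (auto simp: L_weakly_compact_def bounded_iff)
    have "norm (z k) \<le> A + B" for k
      using norm_triangle_ineq4[of "x (r k)" "y k"] A[of "r k"] B[of k] xr[of k] by simp
    then show ?thesis by (auto simp: bounded_iff)
  qed
  then have gz: "(\<lambda>k. g k (T (z k))) \<longlonglongrightarrow> 0"
    using T z g unfolding disjoint_weak_star_DP_def by blast
  \<comment> \<open>Chosen so that \<open>norm T * \<eta>\<close> is at most \<open>e / 2\<close>,
    also when \<open>T\<close> is zero.\<close>
  define \<eta> where "\<eta> = e / (2 * (norm T + 1))"
  have \<eta>: "0 < \<eta>" using e by (simp add: \<eta>_def add_nonneg_pos)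
  obtain u where u: "0 \<le> u" "\<And>k. norm (pprt (\<bar>y k\<bar> - u)) \<le> \<eta>"
    using L_weakly_compact_almost_order_bounded[OF y \<eta>] by blast
  define v where "v k = sup (inf (y k) u) (- u)" for k
  have yv: "norm (y k - v k) \<le> \<eta>" for k
    using order_trans[OF norm_le_of_abs_le_pos[OF truncate_abs_le] u(2)] by (simp add: v_def)
  have uu: "- u \<le> u" using u(1) by (simp add: minus_le_self_iff)
  have v: "- u \<le> v k" "v k \<le> u" for k using uu by (simp_all add: v_def)
  obtain s where s: "strict_mono s" "(\<lambda>n. g (s n) (T (v (s n)))) \<longlonglongrightarrow> 0"
    using weak_star_null_order_bounded[where v = v and T = T, OF ocn dp g v] by blast
  have "(\<lambda>n. g (s n) (T (z (s n)))) \<longlonglongrightarrow> 0"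
    using LIMSEQ_subseq_LIMSEQ[OF gz s(1)] by (simp add: comp_def)
  from tendsto_add[OF s(2) this]
  have lim: "(\<lambda>n. g (s n) (T (v (s n))) + g (s n) (T (z (s n)))) \<longlonglongrightarrow> 0" by simp
  have "e / 2 \<le> g k (T (v k)) + g k (T (z k))" for k
  proof -
    have "\<bar>g k (T (y k - v k))\<bar> \<le> norm (T (y k - v k))" by (rule g_le)
    also have "\<dots> \<le> norm T * norm (y k - v k)" by (rule norm_blinfun)
    also have "\<dots> \<le> norm T * \<eta>" using yv by (intro mult_left_mono) simp_all
    also have "\<dots> \<le> (norm T + 1) * \<eta>" using \<eta> by (intro mult_right_mono) simp_all
    also have "\<dots> = e / 2"
    proof -
      have "norm T + 1 \<noteq> 0" using norm_ge_zero[of T] by linarith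
      then show ?thesis by (simp add: \<eta>_def field_simps)
    qed
    finally have "g k (T (y k - v k)) \<le> e / 2" by linarith
    moreover have "g k (T (x (r k))) = g k (T (y k - v k)) + (g k (T (v k)) + g k (T (z k)))"
      by (simp add: xr blinfun.add_right blinfun.diff_right)
    moreover have "e \<le> g k (T (x (r k)))" using ge by (simp add: g_def)
    ultimately show ?thesis by linarith
  qed
  then have "e / 2 \<le> 0" using LIMSEQ_le_const[OF lim] by blast
  then show False using e by simp
qed

theorem proposition3p11:
  fixes T :: "'e::banach_lattice \<Rightarrow>\<^sub>L 'f::banach_lattice"
  assumes "subsequence_splitting_property TYPE('e)"
    and "order_continuous_norm TYPE('f)"
    and "DP_star_property TYPE('f)"
    and "disjoint_weak_star_DP T"
  shows "L_weakly_compact_op T"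
proof -
  have "u \<longlonglongrightarrow> 0"
    if hull: "\<And>n. u n \<in> solid_hull (blinfun_apply T ` cball 0 1)" and disj: "disjoint_seq u" for u
  proof (rule ccontr)
    assume "\<not> u \<longlonglongrightarrow> 0"
    then obtain e where e: "0 < e" and "\<forall>N. \<exists>n\<ge>N. e \<le> norm (u n)"
      by (auto simp: LIMSEQ_iff not_less)
    then have inf: "infinite {n. e \<le> norm (u n)}"
      by (auto simp: infinite_nat_iff_unbounded_le)
    define w where "w = u \<circ> enumerate {n. e \<le> norm (u n)}"
    have mono: "strict_mono (enumerate {n. e \<le> norm (u n)})" using inf by (rule strict_mono_enumerate)
    have w: "e \<le> norm (w n)" for n
      using enumerate_in_set[OF inf, of n] by (simp add: w_def)
    have w_disj: "disjoint_seq w"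
      using disj strict_mono_eq[OF mono] by (simp add: disjoint_seq_def w_def)
    have "\<exists>x. norm x \<le> 1 \<and> \<bar>w n\<bar> \<le> \<bar>T x\<bar>" for n
      using hull[of "enumerate {n. e \<le> norm (u n)} n"] by (auto simp: solid_hull_def w_def)
    then obtain x where x: "\<And>n. norm (x n) \<le> 1" "\<And>n. \<bar>w n\<bar> \<le> \<bar>T (x n)\<bar>" by metis
    \<comment> \<open>Norming \<open>T (x n)\<close> on the band of \<open>w n\<close> reconciles
      two demands: the functionals inherit weak* nullity from the disjointness of \<open>w\<close>,
      yet detect the part of \<open>T (x n)\<close> that dominates \<open>w n\<close>.\<close>
    have "\<exists>h::'f \<Rightarrow>\<^sub>L real. (\<forall>y. \<bar>h y\<bar> \<le> band_norm (w n) y) \<and> h (T (x n)) = band_norm (w n) (T (x n))" for n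
      by (rule band_functional_exists)
    then obtain h :: "nat \<Rightarrow> 'f \<Rightarrow>\<^sub>L real" where h: "\<And>n y. \<bar>h n y\<bar> \<le> band_norm (w n) y"
      "\<And>n. h n (T (x n)) = band_norm (w n) (T (x n))"
      by metis
    have "weak_star_null h"
      unfolding weak_star_null_def
    proof
      fix y
      show "(\<lambda>n. h n y) \<longlonglongrightarrow> 0"
        by (rule Lim_null_comparison[OF _ band_norm_disjoint_tendsto_0[OF assms(2) w_disj, of y]])
          (simp add: h(1))
    qed
    moreover have "\<bar>h n y\<bar> \<le> norm y" for n y
      using order_trans[OF h(1) band_norm_le_norm] .
    moreover have "bounded (range x)" using x(1) by (auto simp: bounded_iff)
    ultimately obtain n where "h n (T (x n)) < e"
      using weak_star_null_disjoint_wDP[OF assms(1,3,4) _ _ _ e] by metis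
    moreover have "e \<le> h n (T (x n))"
    proof -
      \<comment> \<open>The multiple \<open>k = 1\<close> suffices, since
        \<open>\<bar>w n\<bar>\<close> already lies below
        \<open>\<bar>T (x n)\<bar>\<close>.\<close>
      have "e \<le> norm (inf \<bar>T (x n)\<bar> (1 *\<^sub>R \<bar>w n\<bar>))"
        using w[of n] x(2)[of n] by (simp add: inf_absorb2 norm_abs_lattice)
      then show ?thesis unfolding h(2) using band_norm_ge[of 1 "T (x n)" "w n"] by simp
    qed
    ultimately show False by simp
  qed
  moreover have "bounded (blinfun_apply T ` cball 0 1)"
    by (intro bounded_linear_image bounded_cball blinfun.bounded_linear_right)
  ultimately show ?thesis
    unfolding L_weakly_compact_op_def L_weakly_compact_def by blast
qed

end
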